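(* For every integer $d \geq 4$ there exist functions $\Psi_1, \dots, \Psi_{d-2} : \mathbb{R}_+^2 \to \mathbb{R}_+$, each non-decreasing in both variables, such that the basis of intervals in $\mathbb{R}^d$ with dimensions $$s \times t \times \Psi_1(s,t) \times \dots \times \Psi_{d-2}(s,t), \quad s,t \in \mathbb{R}_+,$$ does not differentiate $L(\log L)^{d-3}$.
   Context: Here $\mathbb{R}_+ = (0,\infty)$. An interval in $\mathbb{R}^d$ is a cartesian product of $d$ bounded one-dimensional intervals, and it has dimensions $\ell_1 \times \dots \times \ell_d$ if its $i$-th factor has length $\ell_i$. The basis in the claim consists of all intervals in $\mathbb{R}^d$ having the displayed dimensions for some $s,t \in \mathbb{R}_+$. A basis is a collection of bounded measurable subsets of $\mathbb{R}^d$. A basis $\mathcal{B}$ differentiates a function space $X$ if for every $f \in X$, for almost every $x$, $$\lim_{j\to\infty} \frac{1}{|R_j|}\int_{R_j} f(y)\,dy = f(x)$$ for every sequence $\{R_j\}$ of elements of $\mathcal{B}$ containing $x$ and with diameters converging to $0$. For $\alpha \ge 0$, $L(\log L)^{\alpha}$ is the space of measurable functions $f$ on $\mathbb{R}^d$ with $\int_{\mathbb{R}^d} |f|\,(1+\log^+|f|)^{\alpha} < \infty$, where $\log^+ u = \max(\log u, 0)$. *)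

theory Defs
  imports "HOL-Analysis.Analysis"
begin

definition differentiation_basis :: "'a::euclidean_space set set \<Rightarrow> bool" where
  "differentiation_basis B \<longleftrightarrow> (\<forall>R\<in>B. bounded R \<and> R \<in> sets lebesgue)"

definition differentiates :: "'a::euclidean_space set set \<Rightarrow> ('a \<Rightarrow> real) set \<Rightarrow> bool" where
  "differentiates B X \<longleftrightarrow>
     (\<forall>f\<in>X. AE x in lebesgue. \<forall>R :: nat \<Rightarrow> 'a set.
        (\<forall>j. R j \<in> B \<and> x \<in> R j) \<and> (\<lambda>j. diameter (R j)) \<longlonglongrightarrow> 0 \<longrightarrow>
        (\<lambda>j. (LINT y:R j|lebesgue. f y) / measure lebesgue (R j)) \<longlonglongrightarrow> f x)"

definition log_plus :: "real \<Rightarrow> real" where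
  "log_plus u = max (ln u) 0"

(* Since ln 0 = 0 in HOL, log_plus 0 = 0, as the convention log 0 = -infinity would give. *)

definition L_log_L :: "real \<Rightarrow> ('a::euclidean_space \<Rightarrow> real) set" where
  "L_log_L \<alpha> = {f \<in> borel_measurable lebesgue.
     (\<integral>\<^sup>+ x. ennreal (\<bar>f x\<bar> * (1 + log_plus \<bar>f x\<bar>) powr \<alpha>) \<partial>lebesgue) < \<infinity>}"

(* The index type 'n of real ^ 'n carries no order. Throughout, e enumerates it by 1, ..., CARD('n),
   so that x $ e i is the i-th coordinate of x. The one-dimensional factors may be open, closed or
   half-open. *)

definition interval_with_dimensions ::
  "(nat \<Rightarrow> 'n::finite) \<Rightarrow> (nat \<Rightarrow> real) \<Rightarrow> (real ^ 'n) set \<Rightarrow> bool" where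
  "interval_with_dimensions e l R \<longleftrightarrow>
     (\<exists>J :: nat \<Rightarrow> real set.
        (\<forall>i\<in>{1..CARD('n)}. is_interval (J i) \<and> bounded (J i) \<and> measure lborel (J i) = l i) \<and>
        R = {x. \<forall>i\<in>{1..CARD('n)}. x $ e i \<in> J i})"

definition side_lengths ::
  "(nat \<Rightarrow> real \<Rightarrow> real \<Rightarrow> real) \<Rightarrow> real \<Rightarrow> real \<Rightarrow> nat \<Rightarrow> real" where
  "side_lengths \<Psi> s t i = (if i = 1 then s else if i = 2 then t else \<Psi> (i - 2) s t)"

definition two_parameter_basis ::
  "(nat \<Rightarrow> 'n::finite) \<Rightarrow> (nat \<Rightarrow> real \<Rightarrow> real \<Rightarrow> real) \<Rightarrow> (real ^ 'n) set set" where
  "two_parameter_basis e \<Psi> =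
     {R. \<exists>s>0. \<exists>t>0. interval_with_dimensions e (side_lengths \<Psi> s t) R}"

lemma differentiation_basis_two_parameter_basis:
  fixes e :: "nat \<Rightarrow> 'n::finite"
  assumes e: "bij_betw e {1..CARD('n)} UNIV"
  shows "differentiation_basis (two_parameter_basis e \<Psi>)"
  unfolding differentiation_basis_def
proof
  fix R assume "R \<in> two_parameter_basis e \<Psi>"
  then obtain J where J: "\<And>i. i \<in> {1..CARD('n)} \<Longrightarrow> is_interval (J i) \<and> bounded (J i)"
    and R: "R = {x. \<forall>i\<in>{1..CARD('n)}. x $ e i \<in> J i}"
    unfolding two_parameter_basis_def interval_with_dimensions_def by blast
  have "\<exists>b. \<forall>x\<in>R. \<bar>x $ k\<bar> \<le> b" for k
  proof -
    obtain i where i: "i \<in> {1..CARD('n)}" "k = e i"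
      using e unfolding bij_betw_def by blast
    obtain b where "\<forall>y\<in>J i. \<bar>y\<bar> \<le> b"
      using J[OF i(1)] unfolding bounded_iff by auto
    with i show ?thesis
      unfolding R by blast
  qed
  then obtain b where b: "\<And>k x. x \<in> R \<Longrightarrow> \<bar>x $ k\<bar> \<le> b k"
    by metis
  have "norm x \<le> (\<Sum>k\<in>UNIV. b k)" if "x \<in> R" for x
    using norm_le_l1_cart[of x] sum_mono[of UNIV "\<lambda>k. \<bar>x $ k\<bar>" b] b[OF that] by fastforce
  then have "bounded R"
    unfolding bounded_iff by blast
  moreover have "convex R"
    using J unfolding R is_interval_convex_1 by (auto simp: convex_def)
  ultimately have "bounded R \<and> R \<in> lmeasurable"
    by (simp add: measurable_convex)
  then show "bounded R \<and> R \<in> sets lebesgue"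
    by (simp add: fmeasurableD)
qed

definition nondecreasing_in_both :: "(real \<Rightarrow> real \<Rightarrow> real) \<Rightarrow> bool" where
  "nondecreasing_in_both F \<longleftrightarrow>
     (\<forall>t>0. mono_on {0<..} (\<lambda>s. F s t)) \<and> (\<forall>s>0. mono_on {0<..} (F s))"

end

theory Submission
  imports Defs
begin

text \<open>
  Monotonicity puts no constraint on \<open>\<Psi>\<close> along an antichain of pairs \<open>(s, t)\<close>. Hence at one scale
  \<open>\<delta>\<close> the basis may contain boxes with sides about \<open>\<delta> 2^(-a_1), ..., \<delta> 2^(-a_d)\<close> for all tuples with
  \<open>a_1 + a_2 = m\<close>, with \<open>a_3, ..., a_(d-1) \<le> m\<close> arbitrary, and with \<open>a_d\<close> chosen so that the volume is
  constant: these are \<open>(m + 1)^(d-2)\<close> tuples with total exponent \<open>(d-2) m\<close>. The boxes of the tuples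
  anchored at one corner contain a common tiny cube, and their union has relative density of order
  \<open>m^(d-2) 2^(-(d-2) m)\<close>, while the multiple of the indicator of the tiny cube whose average over each
  box is about 1 has \<open>L (log L)^(d-3)\<close> size only of order \<open>m^(d-3) 2^(-(d-2) m)\<close>. Repeating the
  configuration periodically at rapidly decreasing dyadic scales, with each \<open>m\<close> used often enough,
  makes the densities non-summable and the sizes summable. As the sets of different scales are
  independent, almost every point of the unit cube lies in infinitely many of the unions, whereas the
  function vanishes outside a set of measure at most 1/2.
\<close>

section \<open>A divergence lemma\<close>

text \<open>Choose indices \<open>\<mu> k\<close> at which the ratio of \<alpha> to \<gamma> is at
  most \<open>(1 / 2) ^ (k + 3)\<close>, and repeat each of them about \<open>1 / \<gamma>\<close>
  times. Block \<open>k\<close> then adds between 1 and 2 to the sum of \<gamma> and at most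
  \<open>(1 / 4) * (1 / 2) ^ k\<close> to the sum of \<alpha>.\<close>

lemma sequence_summable_not_summable:
  fixes \<alpha> \<gamma> :: "nat \<Rightarrow> real"
  assumes \<alpha>: "\<And>n. 0 \<le> \<alpha> n" and \<gamma>: "\<And>n. 0 < \<gamma> n \<and> \<gamma> n \<le> 1"
    and ratio: "\<And>\<epsilon>. 0 < \<epsilon> \<Longrightarrow> \<exists>n. \<alpha> n \<le> \<epsilon> * \<gamma> n"
  obtains g where "summable (\<lambda>j. \<alpha> (g j))" "(\<Sum>j. \<alpha> (g j)) \<le> 1 / 2"
    "\<And>B. \<exists>J. B \<le> (\<Sum>j<J. \<gamma> (g j))"
proof -
  have "\<forall>k. \<exists>n. \<alpha> n \<le> (1 / 2) ^ (k + 3) * \<gamma> n"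
    using ratio by simp
  then obtain \<mu> where \<mu>: "\<And>k. \<alpha> (\<mu> k) \<le> (1 / 2) ^ (k + 3) * \<gamma> (\<mu> k)"
    by metis
  define r where "r k = nat \<lceil>1 / \<gamma> (\<mu> k)\<rceil>" for k
  \<comment> \<open>\<open>S k\<close> is the first position of block \<open>k\<close>, and
    \<open>q j\<close> is the block that contains position \<open>j\<close>.\<close>
  define S where "S k = (\<Sum>i<k. r i)" for k
  define q where "q j = (LEAST k. j < S (Suc k))" for j
  have r_ge: "1 \<le> real (r k) * \<gamma> (\<mu> k)" and r_le: "real (r k) * \<gamma> (\<mu> k) \<le> 2" and r1: "1 \<le> r k" for k
  proof -
    note g = \<gamma>[of "\<mu> k"]
    have "1 / \<gamma> (\<mu> k) \<ge> 0" using g by simp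
    then have "1 / \<gamma> (\<mu> k) \<le> real (r k)" and u: "real (r k) \<le> 1 / \<gamma> (\<mu> k) + 1"
      unfolding r_def by linarith+
    then show "1 \<le> real (r k) * \<gamma> (\<mu> k)" using g by (simp add: field_simps)
    then show "1 \<le> r k" by (cases "r k") auto
    have "real (r k) * \<gamma> (\<mu> k) \<le> (1 / \<gamma> (\<mu> k) + 1) * \<gamma> (\<mu> k)"
      using u g by (intro mult_right_mono) auto
    also have "\<dots> = 1 + \<gamma> (\<mu> k)" using g by (simp add: field_simps)
    finally show "real (r k) * \<gamma> (\<mu> k) \<le> 2" using g by simp
  qed
  have S_mono: "S i \<le> S j" if "i \<le> j" for i j
    unfolding S_def using that by (intro sum_mono2) auto
  have q_eq: "q j = k" if "S k \<le> j" "j < S (Suc k)" for j k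
    unfolding q_def
  proof (rule Least_equality)
    fix y assume "j < S (Suc y)"
    then show "k \<le> y" using S_mono[of "Suc y" k] that by (meson leD le_less_trans not_less_eq_eq order.strict_trans1)
  qed (fact that)
  have sum_S: "(\<Sum>j<S k. F (\<mu> (q j))) = (\<Sum>i<k. real (r i) * F (\<mu> i))" for F :: "nat \<Rightarrow> real" and k
  proof (induction k)
    case (Suc k)
    have "(\<Sum>j<S (Suc k). F (\<mu> (q j))) = (\<Sum>j<S k. F (\<mu> (q j))) + (\<Sum>j=S k..<S (Suc k). F (\<mu> (q j)))"
      using S_mono[of k "Suc k"] by (simp add: atLeast0LessThan[symmetric] sum.atLeastLessThan_concat)
    also have "(\<Sum>j=S k..<S (Suc k). F (\<mu> (q j))) = (\<Sum>j=S k..<S (Suc k). F (\<mu> k))"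
      by (intro sum.cong) (auto simp: q_eq)
    also have "\<dots> = real (r k) * F (\<mu> k)" by (simp add: S_def)
    finally show ?case using Suc by simp
  qed (simp add: S_def)
  \<comment> \<open>Blocks are nonempty, so the first \<open>k\<close> blocks cover the first
    \<open>k\<close> positions; arbitrary partial sums reduce to sums over whole blocks.\<close>
  have le_S: "k \<le> S k" for k
  proof (induction k)
    case (Suc k) then show ?case using r1[of k] by (simp add: S_def)
  qed simp
  have bound: "(\<Sum>j<k. \<alpha> (\<mu> (q j))) \<le> 1 / 2" for k
  proof -
    have "(\<Sum>j<k. \<alpha> (\<mu> (q j))) \<le> (\<Sum>j<S k. \<alpha> (\<mu> (q j)))"
      using le_S[of k] \<alpha> by (intro sum_mono2) auto
    also have "\<dots> = (\<Sum>i<k. real (r i) * \<alpha> (\<mu> i))" by (rule sum_S)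
    also have "\<dots> \<le> (\<Sum>i<k. (1 / 4) * (1 / 2) ^ i)"
    proof (rule sum_mono)
      fix i
      have "real (r i) * \<alpha> (\<mu> i) \<le> real (r i) * ((1 / 2) ^ (i + 3) * \<gamma> (\<mu> i))"
        by (intro mult_left_mono \<mu>) auto
      also have "\<dots> = (1 / 2) ^ (i + 3) * (real (r i) * \<gamma> (\<mu> i))" by simp
      also have "\<dots> \<le> (1 / 2) ^ (i + 3) * 2" by (intro mult_left_mono r_le) auto
      finally show "real (r i) * \<alpha> (\<mu> i) \<le> (1 / 4) * (1 / 2) ^ i"
        by (simp add: power_add power3_eq_cube)
    qed
    also have "\<dots> = (1 / 4) * (\<Sum>i<k. (1 / 2) ^ i)" by (simp add: sum_distrib_left)
    also have "\<dots> \<le> (1 / 4) * 2"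
      by (intro mult_left_mono) (auto simp: sum_gp_strict)
    finally show ?thesis by simp
  qed
  show thesis
  proof (rule that[of "\<lambda>j. \<mu> (q j)"])
    show s: "summable (\<lambda>j. \<alpha> (\<mu> (q j)))"
      by (rule summableI_nonneg_bounded[OF \<alpha> bound])
    show "(\<Sum>j. \<alpha> (\<mu> (q j))) \<le> 1 / 2" by (rule suminf_le_const[OF s bound])
    fix B :: real
    have "B \<le> real (nat \<lceil>B\<rceil>)" by linarith
    also have "\<dots> = (\<Sum>i<nat \<lceil>B\<rceil>. 1)" by simp
    also have "\<dots> \<le> (\<Sum>i<nat \<lceil>B\<rceil>. real (r i) * \<gamma> (\<mu> i))" by (intro sum_mono r_ge)
    finally show "\<exists>J. B \<le> (\<Sum>j<J. \<gamma> (\<mu> (q j)))" by (metis sum_S)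
  qed
qed

section \<open>Dyadic sets\<close>

text \<open>Half-open sides let dyadic cells partition the space exactly and turn membership into a
  condition on floors.\<close>

definition half_open_box :: "('n::finite \<Rightarrow> real) \<Rightarrow> ('n \<Rightarrow> real) \<Rightarrow> (real ^ 'n) set" where
  "half_open_box l u = {x. \<forall>k. l k \<le> x $ k \<and> x $ k < u k}"

text \<open>Measurability comes from convexity and boundedness; the volume is squeezed between those
  of the open and the closed box, which agree.\<close>

lemma
  fixes l u :: "'n::finite \<Rightarrow> real"
  assumes "\<And>k. l k \<le> u k"
  shows lmeasurable_half_open_box: "half_open_box l u \<in> lmeasurable"
    and measure_half_open_box: "measure lebesgue (half_open_box l u) = (\<Prod>k\<in>UNIV. u k - l k)"
proof -
  let ?a = "\<chi> k. l k" and ?b = "\<chi> k. u k"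
  have sub: "box ?a ?b \<subseteq> half_open_box l u" "half_open_box l u \<subseteq> cbox ?a ?b"
    by (auto simp: half_open_box_def mem_box_cart less_imp_le)
  have "convex (half_open_box l u)"
  proof -
    have "half_open_box l u = (\<Inter>k. {x. l k \<le> x $ k} \<inter> {x. x $ k < u k})"
      by (auto simp: half_open_box_def)
    moreover have "convex {x::real^'n. l k \<le> x $ k}" "convex {x::real^'n. x $ k < u k}" for k
      using convex_halfspace_ge[of "l k" "axis k 1 :: real^'n"]
        convex_halfspace_lt[of "axis k 1 :: real^'n" "u k"]
      by (auto simp: inner_axis' )
    ultimately show ?thesis by (metis (no_types, lifting) convex_INT convex_Int)
  qed
  then show m: "half_open_box l u \<in> lmeasurable"
    by (meson bounded_cbox bounded_subset measurable_convex sub(2))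
  have eq: "measure lebesgue (cbox ?a ?b) = (\<Prod>k\<in>UNIV. u k - l k)"
    using assms by (subst measure_completion) (auto simp: content_cbox_cart interval_eq_empty_cart not_less)
  have "measure lebesgue (box ?a ?b) = measure lebesgue (cbox ?a ?b)"
    by (simp add: measure_lborel_box_eq measure_lborel_cbox_eq)
  moreover have "measure lebesgue (box ?a ?b) \<le> measure lebesgue (half_open_box l u)"
    by (intro measure_mono_fmeasurable sub m) auto
  moreover have "measure lebesgue (half_open_box l u) \<le> measure lebesgue (cbox ?a ?b)"
    using m by (intro measure_mono_fmeasurable sub) auto
  ultimately show "measure lebesgue (half_open_box l u) = (\<Prod>k\<in>UNIV. u k - l k)"
    using eq by simp
qed

definition dyadic_cell :: "nat \<Rightarrow> ('n::finite \<Rightarrow> int) \<Rightarrow> (real ^ 'n) set" where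
  "dyadic_cell p z = half_open_box (\<lambda>k. of_int (z k) / 2 ^ p) (\<lambda>k. (of_int (z k) + 1) / 2 ^ p)"

lemma mem_dyadic_cell_iff: "x \<in> dyadic_cell p z \<longleftrightarrow> (\<forall>k. \<lfloor>2 ^ p * x $ k\<rfloor> = z k)"
  by (auto simp: dyadic_cell_def half_open_box_def floor_eq_iff field_simps)

lemma lmeasurable_dyadic_cell: "dyadic_cell p z \<in> lmeasurable"
  unfolding dyadic_cell_def by (intro lmeasurable_half_open_box) (simp add: divide_right_mono)

lemma measure_dyadic_cell:
  "measure lebesgue (dyadic_cell p z :: (real ^ 'n::finite) set) = (1 / 2 ^ p) ^ CARD('n)"
  unfolding dyadic_cell_def
  by (subst measure_half_open_box) (simp_all add: divide_right_mono diff_divide_distrib[symmetric])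

text \<open>These are the unions of dyadic cells of generation \<open>p\<close>. The formulation by
  floors makes closure under unions and differences immediate.\<close>

definition dyadic_determined :: "nat \<Rightarrow> (real ^ 'n::finite) set \<Rightarrow> bool" where
  "dyadic_determined p S \<longleftrightarrow>
     (\<forall>x y. (\<forall>k. \<lfloor>2 ^ p * x $ k\<rfloor> = \<lfloor>2 ^ p * y $ k\<rfloor>) \<longrightarrow> x \<in> S \<longrightarrow> y \<in> S)"

lemma dyadic_determined_mono:
  assumes "dyadic_determined p S" "p \<le> q"
  shows "dyadic_determined q S"
  unfolding dyadic_determined_def
proof (intro allI impI)
  fix x y :: "real^'a"
  assume *: "\<forall>k. \<lfloor>2 ^ q * x $ k\<rfloor> = \<lfloor>2 ^ q * y $ k\<rfloor>" and "x \<in> S"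
  \<comment> \<open>The coarse cell index is the integer quotient of the fine one, so points sharing
    a fine cell share the coarse one.\<close>
  have "\<lfloor>2 ^ p * v\<rfloor> = \<lfloor>2 ^ q * v\<rfloor> div 2 ^ (q - p)" for v :: real
  proof -
    have "(2::real) ^ q = 2 ^ p * 2 ^ (q - p)"
      using assms(2) by (simp flip: power_add)
    then have "2 ^ p * v = (2 ^ q * v) / real_of_int (2 ^ (q - p))"
      by simp
    then show ?thesis by (metis floor_divide_real_eq_div zero_le_numeral zero_le_power)
  qed
  then show "y \<in> S" using assms(1) * \<open>x \<in> S\<close> unfolding dyadic_determined_def by metis
qed

lemma dyadic_determined_Union:
  "(\<And>S. S \<in> \<S> \<Longrightarrow> dyadic_determined p S) \<Longrightarrow> dyadic_determined p (\<Union>\<S>)"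
  unfolding dyadic_determined_def by blast

lemma dyadic_determined_Diff:
  "dyadic_determined p S \<Longrightarrow> dyadic_determined p T \<Longrightarrow> dyadic_determined p (S - T)"
  unfolding dyadic_determined_def by (metis Diff_iff)

text \<open>For an endpoint on the grid, comparing it with a coordinate is the same as comparing
  floors.\<close>

lemma dyadic_determined_half_open_box:
  assumes "\<And>k. 2 ^ p * l k \<in> \<int>" "\<And>k. 2 ^ p * u k \<in> \<int>"
  shows "dyadic_determined p (half_open_box l u)"
proof -
  have "x \<in> half_open_box l u \<longleftrightarrow>
      (\<forall>k. \<lfloor>2 ^ p * l k\<rfloor> \<le> \<lfloor>2 ^ p * x $ k\<rfloor> \<and> \<lfloor>2 ^ p * x $ k\<rfloor> < \<lfloor>2 ^ p * u k\<rfloor>)" for x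
  proof -
    have "l k \<le> x $ k \<longleftrightarrow> \<lfloor>2 ^ p * l k\<rfloor> \<le> \<lfloor>2 ^ p * x $ k\<rfloor>" 
         "x $ k < u k \<longleftrightarrow> \<lfloor>2 ^ p * x $ k\<rfloor> < \<lfloor>2 ^ p * u k\<rfloor>" for k
      using assms[of k] by (auto simp: le_floor_iff floor_less_iff elim!: Ints_cases)
    then show ?thesis by (auto simp: half_open_box_def)
  qed
  then show ?thesis by (simp add: dyadic_determined_def)
qed

lemma dyadic_determined_UN_cells:
  assumes "dyadic_determined p S" "S \<subseteq> half_open_box (\<lambda>_. 0) (\<lambda>_. 1)"
  obtains Z where "finite Z" "S = (\<Union>z\<in>Z. dyadic_cell p z)"
proof
  let ?Z = "{z \<in> (UNIV \<rightarrow>\<^sub>E {0..<2 ^ p}). dyadic_cell p z \<subseteq> S}"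
  show "finite ?Z" by (simp add: finite_PiE)
  have "x \<in> (\<Union>z\<in>?Z. dyadic_cell p z)" if "x \<in> S" for x
  proof -
    let ?z = "\<lambda>k. \<lfloor>2 ^ p * x $ k\<rfloor>"
    have "dyadic_cell p ?z \<subseteq> S"
    proof
      fix y assume "y \<in> dyadic_cell p ?z"
      then have "\<forall>k. ?z k = \<lfloor>2 ^ p * y $ k\<rfloor>" by (simp add: mem_dyadic_cell_iff)
      then show "y \<in> S" using assms(1) that unfolding dyadic_determined_def by blast
    qed
    moreover have "?z \<in> UNIV \<rightarrow>\<^sub>E {0..<2 ^ p}"
      using assms(2) that by (auto simp: half_open_box_def floor_less_iff subset_iff)
    moreover have "x \<in> dyadic_cell p ?z" by (simp add: mem_dyadic_cell_iff)
    ultimately show ?thesis by blast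
  qed
  then show "S = (\<Union>z\<in>?Z. dyadic_cell p z)" by blast
qed

text \<open>This is the independence of scales: a set \<open>G\<close> that fills a proportion
  \<gamma> of every cell of generation \<open>p\<close> fills the same proportion of any finite
  union of such cells, by adding over the disjoint cells.\<close>

lemma measure_dyadic_determined_Diff_le:
  fixes S G :: "(real ^ 'n::finite) set"
  assumes S: "dyadic_determined p S" "S \<subseteq> half_open_box (\<lambda>_. 0) (\<lambda>_. 1)"
    and G: "G \<in> sets lebesgue"
    and dens: "\<And>z. \<gamma> * (1 / 2 ^ p) ^ CARD('n) \<le> measure lebesgue (dyadic_cell p z \<inter> G)"
  shows "S \<in> lmeasurable" "measure lebesgue (S - G) \<le> (1 - \<gamma>) * measure lebesgue S"
proof -
  obtain Z where Z: "finite Z" "S = (\<Union>z\<in>Z. dyadic_cell p z)"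
    using dyadic_determined_UN_cells[OF S] by blast
  show Sm: "S \<in> lmeasurable" unfolding Z using Z(1) lmeasurable_dyadic_cell by blast
  have disj: "dyadic_cell p z \<inter> dyadic_cell p w = {}" if "z \<noteq> w" for z w :: "'n \<Rightarrow> int"
  proof -
    obtain k where "z k \<noteq> w k" using \<open>z \<noteq> w\<close> by (auto simp: fun_eq_iff)
    then show ?thesis by (auto simp: mem_dyadic_cell_iff)
  qed
  have disj_G: "dyadic_cell p z \<inter> G \<inter> (dyadic_cell p w \<inter> G) = {}" if "z \<noteq> w" for z w :: "'n \<Rightarrow> int"
    using disj[OF that] by blast
  have inter: "dyadic_cell p z \<inter> G \<in> lmeasurable" for z
    by (intro fmeasurable_Int_fmeasurable lmeasurable_dyadic_cell G)
  have "measure lebesgue S = (\<Sum>z\<in>Z. measure lebesgue (dyadic_cell p z))"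
    unfolding Z using Z(1) disj
    by (intro measure_finite_Union)
      (simp_all add: disjoint_family_on_def fmeasurableD2[OF lmeasurable_dyadic_cell]
        image_subset_iff fmeasurableD[OF lmeasurable_dyadic_cell] del: emeasure_completion)
  also have "\<dots> = card Z * (1 / 2 ^ p) ^ CARD('n)" by (simp add: measure_dyadic_cell)
  finally have mS: "measure lebesgue S = card Z * (1 / 2 ^ p) ^ CARD('n)" .
  have SG: "S \<inter> G = (\<Union>z\<in>Z. dyadic_cell p z \<inter> G)" unfolding Z by blast
  have "measure lebesgue (S \<inter> G) = (\<Sum>z\<in>Z. measure lebesgue (dyadic_cell p z \<inter> G))"
    unfolding SG using Z(1) disj_G
    by (intro measure_finite_Union)
      (simp_all add: disjoint_family_on_def fmeasurableD2[OF inter]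
        image_subset_iff fmeasurableD[OF inter] del: emeasure_completion)
  also have "\<dots> \<ge> (\<Sum>z\<in>Z. \<gamma> * (1 / 2 ^ p) ^ CARD('n))" by (intro sum_mono dens)
  finally have "\<gamma> * measure lebesgue S \<le> measure lebesgue (S \<inter> G)" by (simp add: mS mult_ac)
  moreover have "measure lebesgue (S - G) = measure lebesgue S - measure lebesgue (S \<inter> G)"
  proof -
    have "S \<inter> G \<in> lmeasurable" using Sm G by (simp add: fmeasurable_Int_fmeasurable)
    moreover have "S - G = S - S \<inter> G" by blast
    ultimately show ?thesis using Sm
      by (metis Int_lower1 fmeasurableD measurable_measure_Diff)
  qed
  ultimately show "measure lebesgue (S - G) \<le> (1 - \<gamma>) * measure lebesgue S"
    by (simp add: algebra_simps)
qed

section \<open>Exponent tuples\<close>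

text \<open>Digit \<open>n\<close> together with the quotient by \<open>B ^ Suc n\<close> recovers
  the quotient by \<open>B ^ n\<close>; descending to \<open>B ^ 0\<close> recovers the
  number.\<close>

lemma eq_if_digits_eq:
  fixes c c' B :: nat
  assumes "\<And>r. r < n \<Longrightarrow> c div B ^ r mod B = c' div B ^ r mod B" "c div B ^ n = c' div B ^ n"
  shows "c = c'"
  using assms
proof (induction n)
  case (Suc n)
  have split: "x div B ^ n = x div B ^ Suc n * B + x div B ^ n mod B" for x
    by (simp add: div_mult2_eq mult.commute[of B])
  show ?case
  proof (rule Suc.IH)
    show "c div B ^ n = c' div B ^ n"
      using split[of c] split[of c'] Suc.prems(1)[of n] Suc.prems(2) by simp
  qed (use Suc.prems(1) in simp)
qed simp

text \<open>Encodes the tuple (a_1, ..., a_d) by one index \<open>c < (m + 1) ^ (d - 2)\<close>. In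
  base \<open>m + 1\<close>, the top digit of \<open>c\<close> is a_2 and the lower
  \<open>d - 3\<close> digits are a_3, ..., a_(d-1). The entries a_1 and a_d are complements, making
  a_1 + a_2 equal to \<open>m\<close> and a_3 + ... + a_d equal to
  \<open>(d - 3) * m\<close>.\<close>

definition exponent :: "nat \<Rightarrow> nat \<Rightarrow> nat \<Rightarrow> nat \<Rightarrow> nat" where
  "exponent d m c i =
     (if i = 1 then m - c div (m + 1) ^ (d - 3)
      else if i = 2 then c div (m + 1) ^ (d - 3)
      else if i < d then c div (m + 1) ^ (i - 3) mod (m + 1)
      else (d - 3) * m - (\<Sum>r<d - 3. c div (m + 1) ^ r mod (m + 1)))"

lemma top_digit_le:
  fixes c m :: nat
  assumes "3 \<le> d" "c < (m + 1) ^ (d - 2)"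
  shows "c div (m + 1) ^ (d - 3) \<le> m"
proof -
  have "(m + 1) ^ (d - 2) = (m + 1) * (m + 1) ^ (d - 3)"
    using assms(1) by (subst power_Suc[symmetric]) (simp add: Suc_diff_le[symmetric])
  then have "c div (m + 1) ^ (d - 3) < m + 1"
    using assms(2) less_mult_imp_div_less by metis
  then show ?thesis by simp
qed

lemma mod_Suc_le: "x mod (m + 1) \<le> (m::nat)"
  using mod_less_divisor[of "m + 1" x] by linarith

text \<open>A crude uniform bound: it lets one tiny cube of relative side
  \<open>1 / 2 ^ (d * m)\<close> fit into the boxes of all tuples, and it determines the gap between
  scales.\<close>

lemma exponent_le:
  assumes "3 \<le> d" "c < (m + 1) ^ (d - 2)"
  shows "exponent d m c i \<le> d * m"
proof -
  have "m \<le> d * m" using assms(1) by (cases d) auto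
  have "(d - 3) * m - x \<le> d * m" for x
    by (rule order.trans[OF diff_le_self]) simp
  moreover have "m - x \<le> d * m" for x
    using \<open>m \<le> d * m\<close> by (rule order.trans[OF diff_le_self])
  moreover have "c div (m + 1) ^ (i - 3) mod (m + 1) \<le> d * m" "c div (m + 1) ^ (d - 3) \<le> d * m"
    using \<open>m \<le> d * m\<close> top_digit_le[OF assms] mod_Suc_le order.trans by blast+
  ultimately show ?thesis
    unfolding exponent_def by presburger
qed

text \<open>Digits are at most \<open>m\<close>, so the natural-number subtractions in the two
  complementary entries are not truncated. The constant total gives all boxes of one scale
  comparable volume.\<close>

lemma sum_exponent:
  assumes "3 \<le> d" "c < (m + 1) ^ (d - 2)"
  shows "(\<Sum>i=1..d. exponent d m c i) = (d - 2) * m"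
proof -
  obtain n where d: "d = Suc (Suc (Suc n))"
    using assms(1) by (metis numeral_3_eq_3 le_Suc_ex add_Suc)
  let ?s = "\<Sum>r<n. c div (m + 1) ^ r mod (m + 1)"
  have "?s \<le> n * m"
    using sum_bounded_above[of "{..<n}" "\<lambda>r. c div (m + 1) ^ r mod (m + 1)" m] mod_Suc_le by simp
  have "(\<Sum>i=1..d. exponent d m c i) = (\<Sum>k<d. exponent d m c (Suc k))"
    by (simp add: sum.atLeast1_atMost_eq)
  also have "\<dots> = exponent d m c 1 + (exponent d m c 2 +
      ((\<Sum>k<n. exponent d m c (k + 3)) + exponent d m c d))"
    unfolding d by (subst sum.lessThan_Suc_shift, subst sum.lessThan_Suc_shift, subst sum.lessThan_Suc)
      (simp add: numeral_2_eq_2 numeral_3_eq_3)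
  also have "(\<Sum>k<n. exponent d m c (k + 3)) = ?s"
    by (intro sum.cong) (auto simp: exponent_def d)
  also have "exponent d m c d = n * m - ?s"
    by (simp add: exponent_def d)
  also have "exponent d m c 1 = m - c div (m + 1) ^ n"
    by (simp add: exponent_def d)
  also have "exponent d m c 2 = c div (m + 1) ^ n"
    by (simp add: exponent_def d)
  finally show ?thesis
    using top_digit_le[OF assms] \<open>?s \<le> n * m\<close> by (simp add: d)
qed

text \<open>Entries 2 to \<open>d - 1\<close> already list all the digits of the index.\<close>

lemma exponent_inj:
  assumes "3 \<le> d" "\<And>i. i \<in> {1..d} \<Longrightarrow> exponent d m c i = exponent d m c' i"
  shows "c = c'"
proof (rule eq_if_digits_eq)
  show "c div (m + 1) ^ (d - 3) = c' div (m + 1) ^ (d - 3)"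
    using assms(1) assms(2)[of 2] by (simp add: exponent_def)
  show "c div (m + 1) ^ r mod (m + 1) = c' div (m + 1) ^ r mod (m + 1)" if "r < d - 3" for r
    using that assms(2)[of "r + 3"] by (simp add: exponent_def less_diff_conv)
qed

section \<open>Disjoint pieces of the anchored boxes\<close>

definition dyadic_shell :: "nat \<Rightarrow> ('n::finite \<Rightarrow> int) \<Rightarrow> ('n \<Rightarrow> nat) \<Rightarrow> (real ^ 'n) set" where
  "dyadic_shell p z b = half_open_box
     (\<lambda>k. (of_int (z k) + 1 / 2 ^ (b k + 1)) / 2 ^ p) (\<lambda>k. (of_int (z k) + 1 / 2 ^ b k) / 2 ^ p)"

lemma dyadic_shell_le: "(real_of_int y + 1 / 2 ^ (a + 1)) / 2 ^ p \<le> (of_int y + 1 / 2 ^ a) / 2 ^ p"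
  by (intro divide_right_mono add_left_mono) (auto simp: field_simps)

lemma lmeasurable_dyadic_shell: "dyadic_shell p z b \<in> lmeasurable"
  unfolding dyadic_shell_def by (intro lmeasurable_half_open_box dyadic_shell_le)

lemma measure_dyadic_shell:
  "measure lebesgue (dyadic_shell p z b :: (real ^ 'n::finite) set) =
     (1 / 2 ^ p) ^ CARD('n) / 2 ^ ((\<Sum>k\<in>UNIV. b k) + CARD('n))"
proof -
  have "measure lebesgue (dyadic_shell p z b) = (\<Prod>k\<in>UNIV. (1 / 2 ^ p) * (1 / 2 ^ b k) * (1 / 2))"
    unfolding dyadic_shell_def
    by (subst measure_half_open_box[OF dyadic_shell_le], intro prod.cong)
      (auto simp: field_simps)
  also have "\<dots> = (1 / 2 ^ p) ^ CARD('n) * (1 / 2 ^ (\<Sum>k\<in>UNIV. b k)) * (1 / 2) ^ CARD('n)"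
    by (simp add: prod.distrib prod_dividef power_sum power_divide)
  finally show ?thesis by (simp add: power_add power_divide)
qed

lemma dyadic_shell_subset_cell: "dyadic_shell p z b \<subseteq> dyadic_cell p z"
proof
  fix x assume x: "x \<in> dyadic_shell p z b"
  have "of_int (z k) / 2 ^ p \<le> x $ k \<and> x $ k < (of_int (z k) + 1) / 2 ^ p" for k
  proof -
    have "of_int (z k) / 2 ^ p \<le> (of_int (z k) + 1 / 2 ^ (b k + 1)) / (2::real) ^ p"
      "(of_int (z k) + 1 / 2 ^ b k) / 2 ^ p \<le> (of_int (z k) + 1) / (2::real) ^ p"
      by (intro divide_right_mono; simp)+
    then show ?thesis
      using x[unfolded dyadic_shell_def half_open_box_def, simplified, rule_format, of k] by simp
  qed
  then show "x \<in> dyadic_cell p z" by (simp add: dyadic_cell_def half_open_box_def)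
qed

text \<open>Boxes anchored at one corner overlap; a shell keeps only the upper half of each side.
  Along one coordinate the shells are rescaled translates of the intervals from
  \<open>1 / 2 ^ (a + 1)\<close> to \<open>1 / 2 ^ a\<close>, which are disjoint for different
  \<open>a\<close>, so one differing exponent separates two shells. The price is a factor
  \<open>2 ^ d\<close> in volume.\<close>

lemma dyadic_shell_disjoint:
  assumes "b \<noteq> b'"
  shows "dyadic_shell p z b \<inter> dyadic_shell p z b' = {}"
proof -
  have le: False if "x \<in> dyadic_shell p z b" "x \<in> dyadic_shell p z b'" "b k < b' k" for x b b' k
  proof -
    have "(of_int (z k) + 1 / 2 ^ b' k) / 2 ^ p \<le> (of_int (z k) + 1 / 2 ^ (b k + 1)) / (2::real) ^ p"
      using that(3) by (intro divide_right_mono add_left_mono divide_left_mono power_increasing) auto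
    then show False
      using that(1)[unfolded dyadic_shell_def half_open_box_def, simplified, rule_format, of k]
        that(2)[unfolded dyadic_shell_def half_open_box_def, simplified, rule_format, of k] by simp
  qed
  obtain k where "b k < b' k \<or> b' k < b k"
    using assms by (auto simp: fun_eq_iff neq_iff)
  then show ?thesis using le by blast
qed

text \<open>The endpoints are multiples of \<open>1 / 2 ^ (p + b k + 1)\<close>, hence lie on the
  grid of generation \<open>q\<close>.\<close>

lemma dyadic_determined_shell:
  assumes "\<And>k. p + b k + 1 \<le> q"
  shows "dyadic_determined q (dyadic_shell p z b)"
  unfolding dyadic_shell_def
proof (rule dyadic_determined_half_open_box)
  have *: "2 ^ q * ((of_int y + 1 / 2 ^ a) / 2 ^ p) \<in> (\<int> :: real set)" if "p + a \<le> q" for a y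
  proof -
    have "(2::real) ^ q = 2 ^ p * 2 ^ a * 2 ^ (q - p - a)"
      using that by (simp flip: power_add)
    then have "2 ^ q * ((of_int y + 1 / 2 ^ a) / 2 ^ p) = (2 ^ a * of_int y + 1) * (2::real) ^ (q - p - a)"
      by (simp add: field_simps)
    then show ?thesis by simp
  qed
  show "2 ^ q * ((of_int (z k) + 1 / 2 ^ (b k + 1)) / 2 ^ p) \<in> (\<int> :: real set)"
    "2 ^ q * ((of_int (z k) + 1 / 2 ^ b k) / 2 ^ p) \<in> (\<int> :: real set)" for k
    using assms[of k] by (intro *; simp)+
qed

section \<open>Density of the shells compared with the size of the function\<close>

definition shell_density :: "nat \<Rightarrow> nat \<Rightarrow> real" where
  "shell_density d m = real ((m + 1) ^ (d - 2)) / 2 ^ ((d - 2) * m + d)"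

text \<open>The upper bound for the volume of a box divided by the volume of the tiny cube inside
  it, so that the average over the box is at least 1. The factor 4 accounts for the two sides that
  are stretched by up to 2.\<close>

definition cube_height :: "nat \<Rightarrow> nat \<Rightarrow> real" where
  "cube_height d m = 4 * 2 ^ (d * m * d) / 2 ^ ((d - 2) * m)"

text \<open>Bounds the \<open>L_log_L\<close> integral contributed by one scale: the last factor is
  the total volume of its tiny cubes in the unit cube.\<close>

definition cube_weight :: "nat \<Rightarrow> nat \<Rightarrow> real" where
  "cube_weight d m =
     cube_height d m * (1 + log_plus \<bar>cube_height d m\<bar>) powr real (d - 3) * (1 / 2 ^ (d * m)) ^ d"

lemma shell_density_pos: "0 < shell_density d m"
  by (simp add: shell_density_def)

lemma shell_density_le_1: "shell_density d m \<le> 1"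
proof -
  have "m + 1 \<le> 2 ^ m"
    using less_exp[of m] by linarith
  then have "(m + 1) ^ (d - 2) \<le> (2 ^ m) ^ (d - 2)"
    by (intro power_mono) auto
  also have "\<dots> = 2 ^ ((d - 2) * m)" by (simp add: power_mult[symmetric] mult.commute)
  also have "\<dots> \<le> 2 ^ ((d - 2) * m + d)" by (intro power_increasing) auto
  finally have "(m + 1) ^ (d - 2) \<le> (2::nat) ^ ((d - 2) * m + d)" .
  then have "real ((m + 1) ^ (d - 2)) \<le> real (2 ^ ((d - 2) * m + d))"
    by (rule of_nat_mono)
  then show ?thesis by (simp add: shell_density_def)
qed

lemma cube_height_ge_1: "1 \<le> cube_height d m"
proof -
  have "(d - 2) * m \<le> d * m * 1" by simp
  also have "d * m * 1 \<le> d * m * d" by (cases "d = 0") auto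
  finally have "(2::real) ^ ((d - 2) * m) \<le> 2 ^ (d * m * d)" by (intro power_increasing) auto
  also have "\<dots> \<le> 4 * 2 ^ (d * m * d)" by simp
  finally show ?thesis by (simp only: cube_height_def le_divide_eq_1_pos zero_less_power zero_less_numeral)
qed

lemma log_plus_nonneg: "0 \<le> log_plus u"
  by (simp add: log_plus_def)

text \<open>Height and logarithmic factor are at least 1, so the weights also control the measure of
  the tiny cubes.\<close>

lemma cube_weight_ge: "(1 / 2 ^ (d * m)) ^ d \<le> cube_weight d m"
proof -
  have "1 * 1 \<le> cube_height d m * (1 + log_plus \<bar>cube_height d m\<bar>) powr real (d - 3)"
    using cube_height_ge_1[of d m] log_plus_nonneg[of "\<bar>cube_height d m\<bar>"]
    by (intro mult_mono ge_one_powr_ge_zero) auto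
  then have "1 * (1 / 2 ^ (d * m)) ^ d \<le> cube_weight d m"
    unfolding cube_weight_def by (intro mult_right_mono) auto
  then show ?thesis by simp
qed

text \<open>The height is at most exponential in \<open>m\<close>, so its logarithm is linear in
  \<open>m\<close> and the logarithmic factor costs only \<open>(m + 1) ^ (d - 3)\<close> up to a
  constant.\<close>

lemma cube_weight_le:
  assumes "3 \<le> d"
  shows "cube_weight d m \<le> 4 * (real (3 + d * d) * real (m + 1)) ^ (d - 3) / 2 ^ ((d - 2) * m)"
proof -
  let ?h = "cube_height d m" let ?L = "1 + log_plus \<bar>?h\<bar>"
  have h: "1 \<le> ?h" by (rule cube_height_ge_1)
  have "?h \<le> 2 ^ (2 + d * m * d)"
    by (simp add: cube_height_def power_add divide_le_eq)
  then have "ln ?h \<le> ln (2 ^ (2 + d * m * d))" using h by simp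
  also have "\<dots> = real (2 + d * m * d) * ln 2" by (rule ln_realpow)
  also have "\<dots> \<le> real (2 + d * m * d) * 1"
    using ln_2_less_1 by (intro mult_left_mono) auto
  finally have "?L \<le> real (3 + d * m * d)" using h by (simp add: log_plus_def)
  also have "\<dots> \<le> real ((3 + d * d) * (m + 1))" by (simp only: of_nat_le_iff) (simp add: algebra_simps)
  finally have L: "?L \<le> real (3 + d * d) * real (m + 1)" by (simp only: of_nat_mult)
  have "?L powr real (d - 3) = ?L ^ (d - 3)"
    using log_plus_nonneg[of "\<bar>?h\<bar>"] by (intro powr_realpow) auto
  also have "\<dots> \<le> (real (3 + d * d) * real (m + 1)) ^ (d - 3)"
    using L log_plus_nonneg[of "\<bar>?h\<bar>"] by (intro power_mono) auto
  finally have P: "?L powr real (d - 3) \<le> (real (3 + d * d) * real (m + 1)) ^ (d - 3)" .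
  have eq: "?h * (1 / 2 ^ (d * m)) ^ d = 4 / 2 ^ ((d - 2) * m)"
    by (simp add: cube_height_def power_divide power_mult)
  have "cube_weight d m = (4 / 2 ^ ((d - 2) * m)) * ?L powr real (d - 3)"
    unfolding cube_weight_def eq[symmetric] by simp
  also have "\<dots> \<le> (4 / 2 ^ ((d - 2) * m)) * (real (3 + d * d) * real (m + 1)) ^ (d - 3)"
    by (intro mult_left_mono P) auto
  finally show ?thesis by simp
qed

text \<open>The tuples have \<open>d - 2\<close> free digits while the logarithm has the power
  \<open>d - 3\<close>. The quotient of weight by density is thus at most a constant over
  \<open>m + 1\<close>.\<close>

lemma ex_cube_weight_le_shell_density:
  assumes "3 \<le> d" "0 < \<epsilon>"
  shows "\<exists>m. cube_weight d m \<le> \<epsilon> * shell_density d m"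
proof -
  let ?C = "4 * real (3 + d * d) ^ (d - 3) * 2 ^ d"
  obtain k :: nat where k: "?C / \<epsilon> < real k" using reals_Archimedean2 by blast
  let ?m = "Suc k"
  have C: "?C \<le> \<epsilon> * real (?m + 1)"
  proof -
    have "?C < \<epsilon> * real k" using k assms(2) by (simp add: field_simps)
    also have "\<dots> \<le> \<epsilon> * real (?m + 1)" using assms(2) by (intro mult_left_mono) auto
    finally show ?thesis by simp
  qed
  let ?q = "real (?m + 1) ^ (d - 3)" let ?D = "(2::real) ^ ((d - 2) * ?m)"
  have pw: "real (?m + 1) * ?q = real (?m + 1) ^ (d - 2)"
    using assms(1) by (subst power_Suc[symmetric]) (simp add: Suc_diff_le[symmetric])
  have "cube_weight d ?m \<le> 4 * (real (3 + d * d) ^ (d - 3) * ?q) / ?D"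
    using cube_weight_le[OF assms(1), of ?m] by (simp only: power_mult_distrib)
  also have "\<dots> = ?C * (?q / ?D / 2 ^ d)" by simp
  also have "\<dots> \<le> (\<epsilon> * real (?m + 1)) * (?q / ?D / 2 ^ d)" by (intro mult_right_mono C) auto
  also have "\<dots> = \<epsilon> * ((real (?m + 1) * ?q) / (?D * 2 ^ d))" by simp
  also have "\<dots> = \<epsilon> * shell_density d ?m"
    unfolding pw shell_density_def by (simp only: power_add of_nat_power)
  finally show ?thesis by (intro exI[of _ ?m])
qed

section \<open>The basis\<close>

locale sparse_boxes =
  fixes e :: "nat \<Rightarrow> 'n::finite" and d :: nat and m :: "nat \<Rightarrow> nat"
  assumes d: "3 \<le> d" and card: "CARD('n) = d" and bij: "bij_betw e {1..d} UNIV"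
begin

text \<open>Scale \<open>j\<close> lives in cells of side \<open>1 / 2 ^ p j\<close>. The increment
  reserves \<open>d * m\<close> generations for the exponents. The extra 2 keeps all sides of scale
  \<open>j + 1\<close>, even when doubled, strictly below all sides of scale \<open>j\<close>, and
  leaves room for the endpoints of the shells.\<close>

definition p :: "nat \<Rightarrow> nat" where "p j = (\<Sum>l<j. d * m l + 2)"
definition N :: "nat \<Rightarrow> nat" where "N j = (m j + 1) ^ (d - 2)"
definition b :: "nat \<Rightarrow> nat \<Rightarrow> nat \<Rightarrow> nat" where "b j c i = exponent d (m j) c i"
text \<open>
  The index \<open>c\<close> is sorted by its top base-\<open>(m + 1)\<close> digit \<open>a_2\<close>; the factors \<open>1 + c / N\<close> and \<open>2 - c / N\<close> make
  side 1 strictly increasing and side 2 strictly decreasing in \<open>c\<close>, so that tuples sharing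
  \<open>(a_1, a_2)\<close> also get incomparable pairs \<open>(s, t)\<close>.
\<close>
definition side :: "nat \<Rightarrow> nat \<Rightarrow> nat \<Rightarrow> real" where
  "side j c i =
     (if i = 1 then 1 + real c / real (N j) else if i = 2 then 2 - real c / real (N j) else 1) *
     (1 / 2 ^ b j c i * (1 / 2 ^ p j))"
text \<open>Extends the values prescribed on the pairs of first two sides to a function monotone by
  construction: increasing \<open>x\<close> or \<open>y\<close> only enlarges the set.\<close>

definition \<Psi> :: "nat \<Rightarrow> real \<Rightarrow> real \<Rightarrow> real" where
  "\<Psi> k x y = Sup {side j c (k + 2) | j c. c < N j \<and> side j c 1 \<le> x \<and> side j c 2 \<le> y}"

lemma N_pos: "0 < N j" by (simp add: N_def)

lemma b_le: "c < N j \<Longrightarrow> b j c i \<le> d * m j"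
  using exponent_le d unfolding N_def b_def by simp

lemma p_Suc: "p (Suc j) = p j + d * m j + 2" by (simp add: p_def)

lemma p_mono: "i \<le> j \<Longrightarrow> p i \<le> p j"
  unfolding p_def by (intro sum_mono2) auto

lemma le_p: "j \<le> p j"
  by (induction j) (auto simp: p_Suc)

lemma side_bounds:
  assumes "c < N j"
  shows "1 / 2 ^ b j c i * (1 / 2 ^ p j) \<le> side j c i"
    and "side j c i \<le> (if i = 1 \<or> i = 2 then 2 else 1) * (1 / 2 ^ b j c i * (1 / 2 ^ p j))"
proof -
  have c: "0 \<le> real c / real (N j)" "real c / real (N j) \<le> 1" using assms by auto
  have "1 * (1 / 2 ^ b j c i * (1 / 2 ^ p j)) \<le> side j c i"
    unfolding side_def using c by (intro mult_right_mono) auto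
  then show "1 / 2 ^ b j c i * (1 / 2 ^ p j) \<le> side j c i" by simp
  show "side j c i \<le> (if i = 1 \<or> i = 2 then 2 else 1) * (1 / 2 ^ b j c i * (1 / 2 ^ p j))"
    unfolding side_def using c by (intro mult_right_mono) auto
qed

lemma side_ge:
  assumes "c < N j"
  shows "1 / 2 ^ (p j + d * m j) \<le> side j c i"
proof -
  have "1 / 2 ^ (p j + d * m j) \<le> 1 / (2::real) ^ (p j + b j c i)"
    using b_le[OF assms] by (intro divide_left_mono power_increasing) auto
  also have "\<dots> = 1 / 2 ^ b j c i * (1 / 2 ^ p j)" by (simp add: power_add)
  finally show ?thesis using side_bounds(1)[OF assms] by (rule order.trans)
qed

lemma side_pos: "c < N j \<Longrightarrow> 0 < side j c i"
  using side_ge[of c j i] by (rule less_le_trans[rotated]) auto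

lemma side_le:
  assumes "c < N j"
  shows "side j c i \<le> 2 / 2 ^ p j"
proof -
  have "side j c i \<le> (if i = 1 \<or> i = 2 then 2 else 1) * (1 / 2 ^ b j c i * (1 / 2 ^ p j))"
    by (rule side_bounds[OF assms])
  also have "\<dots> \<le> 2 * (1 * (1 / 2 ^ p j))"
    by (intro mult_mono) auto
  finally show ?thesis by simp
qed

lemma side_less:
  assumes "c < N j" "c' < N j'" "j < j'"
  shows "side j' c' i' < side j c i"
proof -
  have "side j' c' i' \<le> 2 / 2 ^ p j'" by (rule side_le[OF assms(2)])
  also have "\<dots> \<le> 2 / 2 ^ p (Suc j)"
    using p_mono[of "Suc j" j'] assms(3) by (intro divide_left_mono power_increasing) auto
  also have "\<dots> < 1 / 2 ^ (p j + d * m j)"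
    by (simp add: p_Suc power_add field_simps)
  also have "\<dots> \<le> side j c i" by (rule side_ge[OF assms(1)])
  finally show ?thesis .
qed

lemma side_1_less:
  assumes "c < c'" "c' < N j"
  shows "side j c 1 < side j c' 1"
proof -
  have "b j c' 1 \<le> b j c 1"
    unfolding b_def exponent_def using assms by (simp add: div_le_mono diff_le_mono2)
  then have "1 / 2 ^ b j c 1 * (1 / 2 ^ p j) \<le> 1 / 2 ^ b j c' 1 * (1 / (2::real) ^ p j)"
    by (intro mult_right_mono divide_left_mono power_increasing) auto
  moreover have "1 + real c / real (N j) < 1 + real c' / real (N j)"
    using assms N_pos[of j] by (simp add: divide_strict_right_mono)
  ultimately show ?thesis
    unfolding side_def by (simp only: if_True simp_thms) (intro mult_less_le_imp_less; simp add: add_pos_nonneg)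
qed

lemma side_2_less:
  assumes "c < c'" "c' < N j"
  shows "side j c' 2 < side j c 2"
proof -
  have "b j c 2 \<le> b j c' 2"
    unfolding b_def exponent_def using assms by (simp add: div_le_mono)
  then have "1 / 2 ^ b j c' 2 * (1 / 2 ^ p j) \<le> 1 / 2 ^ b j c 2 * (1 / (2::real) ^ p j)"
    by (intro mult_right_mono divide_left_mono power_increasing) auto
  moreover have "2 - real c' / real (N j) < 2 - real c / real (N j)"
    using assms N_pos[of j] by (simp add: divide_strict_right_mono)
  moreover have "real c' / real (N j) < 1" using assms by simp
  ultimately show ?thesis
    unfolding side_def by (simp only: if_True if_False simp_thms numeral_eq_one_iff semiring_norm)
      (intro mult_less_le_imp_less; simp)
qed

text \<open>Within one scale the pairs of first two sides form an antichain, since side 1 increases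
  and side 2 decreases with \<open>c\<close>. Between scales every side of the later one is smaller.
  Comparable pairs are therefore equal or ordered in all sides, which makes the prescription
  consistent with monotonicity.\<close>

lemma side_mono:
  assumes "c < N j" "c' < N j'" "side j c 1 \<le> side j' c' 1" "side j c 2 \<le> side j' c' 2"
  shows "side j c i \<le> side j' c' i"
proof (cases j j' rule: linorder_cases)
  case less
  then show ?thesis using side_less[OF assms(1,2), of 1 1] assms(3) by simp
next
  case equal
  then have "c = c'" using side_1_less[of c' c j] side_2_less[of c c' j] assms
    by (metis linorder_neqE_nat not_less)
  then show ?thesis using equal by simp
next
  case greater
  then show ?thesis using side_less[OF assms(2,1), of i i] by simp
qed

lemma bdd_above_sides: "bdd_above {side j c i | j c. c < N j \<and> P j c}"
proof (rule bdd_aboveI)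
  fix x assume "x \<in> {side j c i | j c. c < N j \<and> P j c}"
  then obtain j c where "x = side j c i" "c < N j" by blast
  then have "x \<le> 2 / 2 ^ p j" using side_le by simp
  also have "\<dots> \<le> 2" by (simp add: field_simps)
  finally show "x \<le> 2" .
qed

text \<open>By \<open>side_mono\<close> the supremum is a maximum, attained at the pair
  itself.\<close>

lemma \<Psi>_side:
  assumes "c < N j"
  shows "\<Psi> k (side j c 1) (side j c 2) = side j c (k + 2)"
  unfolding \<Psi>_def using assms side_mono by (intro cSup_eq_maximum) auto

text \<open>Sides shrink to 0 along the scales, so the supremum in \<open>\<Psi>\<close> is never
  taken over the empty set, where its value would be arbitrary.\<close>

lemma ex_side_le:
  assumes "0 < x" "0 < y"
  shows "\<exists>j c. c < N j \<and> side j c 1 \<le> x \<and> side j c 2 \<le> y"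
proof -
  obtain n where n: "(1 / 2) ^ n < min x y / (2::real)"
    using real_arch_pow_inv[of "min x y / 2" "1 / 2"] assms by auto
  have "2 / 2 ^ p n \<le> 2 / (2::real) ^ n"
    using le_p[of n] by (intro divide_left_mono power_increasing) auto
  also have "\<dots> \<le> min x y" using n by (simp add: power_divide)
  finally show ?thesis using side_le[OF N_pos] N_pos by (meson min.boundedE order.trans)
qed

lemma \<Psi>_pos:
  assumes "0 < x" "0 < y"
  shows "0 < \<Psi> k x y"
proof -
  obtain j c where jc: "c < N j" "side j c 1 \<le> x" "side j c 2 \<le> y"
    using ex_side_le[OF assms] by blast
  then have "side j c (k + 2) \<le> \<Psi> k x y"
    unfolding \<Psi>_def by (intro cSup_upper bdd_above_sides) auto
  then show ?thesis using side_pos[OF jc(1)] by (rule less_le_trans[rotated])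
qed

lemma \<Psi>_mono:
  assumes "0 < x" "0 < y" "x \<le> x'" "y \<le> y'"
  shows "\<Psi> k x y \<le> \<Psi> k x' y'"
  unfolding \<Psi>_def
proof (intro cSup_subset_mono bdd_above_sides)
  show "{side j c (k + 2) | j c. c < N j \<and> side j c 1 \<le> x \<and> side j c 2 \<le> y} \<noteq> {}"
    using ex_side_le[OF assms(1,2)] by blast
qed (use assms(3,4) in fastforce)

lemma nondecreasing_\<Psi>: "nondecreasing_in_both (\<Psi> k)"
  unfolding nondecreasing_in_both_def by (auto intro!: mono_onI \<Psi>_mono)

lemma side_lengths_\<Psi>:
  assumes "c < N j" "1 \<le> i"
  shows "side_lengths \<Psi> (side j c 1) (side j c 2) i = side j c i"
proof -
  have "\<Psi> (i - 2) (side j c 1) (side j c 2) = side j c i" if "i \<noteq> 1" "i \<noteq> 2"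
  proof -
    have "i - 2 + 2 = i" using that assms(2) by linarith
    then show ?thesis using \<Psi>_side[OF assms(1), of "i - 2"] by (simp only:)
  qed
  then show ?thesis by (auto simp: side_lengths_def)
qed

section \<open>Boxes of the basis anchored at dyadic lattice points\<close>

definition axis_index :: "'n \<Rightarrow> nat" where "axis_index = inv_into {1..d} e"

lemma bij_axis_index: "bij_betw axis_index UNIV {1..d}"
  unfolding axis_index_def by (rule bij_betw_inv_into[OF bij])

lemma axis_index_e: "i \<in> {1..d} \<Longrightarrow> axis_index (e i) = i"
  unfolding axis_index_def using bij by (simp add: bij_betw_def)

definition basis_box :: "nat \<Rightarrow> nat \<Rightarrow> ('n \<Rightarrow> int) \<Rightarrow> (real ^ 'n) set" where
  "basis_box j c z = half_open_box (\<lambda>k. of_int (z k) / 2 ^ p j)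
     (\<lambda>k. of_int (z k) / 2 ^ p j + side j c (axis_index k))"

lemma bx_in_basis:
  assumes "c < N j"
  shows "basis_box j c z \<in> two_parameter_basis e \<Psi>"
proof -
  \<comment> \<open>With the first two sides as parameters, \<open>\<Psi>\<close> returns the
    remaining sides of the box.\<close>
  let ?l = "side_lengths \<Psi> (side j c 1) (side j c 2)"
  let ?J = "\<lambda>i. {of_int (z (e i)) / 2 ^ p j ..< of_int (z (e i)) / 2 ^ p j + ?l i}"
  have l: "?l i = side j c i" if "i \<in> {1..d}" for i
    using side_lengths_\<Psi>[OF assms] that by simp
  have "basis_box j c z = {x. \<forall>i\<in>{1..d}. x $ e i \<in> ?J i}"
  proof (rule set_eqI)
    fix x
    have "x \<in> basis_box j c z \<longleftrightarrow> (\<forall>k\<in>e ` {1..d}. of_int (z k) / 2 ^ p j \<le> x $ k \<and>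
        x $ k < of_int (z k) / 2 ^ p j + side j c (axis_index k))"
      using bij by (simp add: basis_box_def half_open_box_def bij_betw_def)
    also have "\<dots> \<longleftrightarrow> x \<in> {x. \<forall>i\<in>{1..d}. x $ e i \<in> ?J i}"
      using l by (simp add: axis_index_e)
    finally show "x \<in> basis_box j c z \<longleftrightarrow> x \<in> {x. \<forall>i\<in>{1..d}. x $ e i \<in> ?J i}" .
  qed
  moreover have "is_interval (?J i) \<and> bounded (?J i) \<and> measure lborel (?J i) = ?l i" if "i \<in> {1..d}" for i
    using side_pos[OF assms, of i] l[OF that] by (auto simp: is_interval_co)
  ultimately have "interval_with_dimensions e ?l (basis_box j c z)"
    unfolding interval_with_dimensions_def card by (intro exI[of _ ?J]) auto
  then show ?thesis
    unfolding two_parameter_basis_def using side_pos[OF assms] by blast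
qed

lemma lmeasurable_basis_box: "c < N j \<Longrightarrow> basis_box j c z \<in> lmeasurable"
  unfolding basis_box_def by (intro lmeasurable_half_open_box) (simp add: less_imp_le side_pos)

lemma measure_basis_box: "c < N j \<Longrightarrow> measure lebesgue (basis_box j c z) = (\<Prod>i=1..d. side j c i)"
  unfolding basis_box_def
  by (subst measure_half_open_box)
    (simp_all add: less_imp_le side_pos prod.reindex_bij_betw[OF bij_axis_index, of "side j c"] del: One_nat_def)

lemma measure_basis_box_pos: "c < N j \<Longrightarrow> 0 < measure lebesgue (basis_box j c z)"
  by (simp add: measure_basis_box prod_pos side_pos)

text \<open>The exponents add up to \<open>(d - 2) * m j\<close>, and only sides 1 and 2 carry an
  extra factor, each at most 2.\<close>

lemma measure_basis_box_le:
  assumes "c < N j"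
  shows "measure lebesgue (basis_box j c z) \<le> 4 / 2 ^ ((d - 2) * m j) * (1 / 2 ^ p j) ^ d"
proof -
  have "(\<Prod>i=1..d. side j c i) \<le>
      (\<Prod>i=1..d. (if i = 1 \<or> i = 2 then 2 else 1) * (1 / 2 ^ b j c i * (1 / 2 ^ p j)))"
    using side_bounds(2)[OF assms] side_pos[OF assms] by (intro prod_mono) (auto simp: less_imp_le)
  also have "\<dots> = (\<Prod>i=1..d. if i = 1 \<or> i = 2 then 2 else 1) *
      ((\<Prod>i=1..d. 1 / 2 ^ b j c i) * (1 / 2 ^ p j) ^ d)"
    by (simp only: prod.distrib prod_constant card_atLeastAtMost) simp
  also have "(\<Prod>i=1..d. if i = 1 \<or> i = 2 then 2 else 1) = (4::real)"
  proof -
    have "(\<Prod>i=1..d. if i = 1 \<or> i = 2 then 2 else 1) = (\<Prod>i\<in>{1, 2::nat}. (2::real))"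
      using d by (intro prod.mono_neutral_cong_right) auto
    then show ?thesis by simp
  qed
  also have "(\<Prod>i=1..d. 1 / 2 ^ b j c i) = 1 / (2::real) ^ ((d - 2) * m j)"
    using sum_exponent[OF d, of c "m j"] assms
    by (simp add: prod_dividef power_sum[symmetric] b_def N_def)
  finally show ?thesis using measure_basis_box[OF assms] by simp
qed

lemma diameter_basis_box_le:
  assumes "c < N j"
  shows "diameter (basis_box j c z) \<le> real d * (2 / 2 ^ p j)"
proof (rule diameter_le)
  fix x y assume xy: "x \<in> basis_box j c z" "y \<in> basis_box j c z"
  have "\<bar>(x - y) $ k\<bar> \<le> 2 / 2 ^ p j" for k
    using xy[unfolded basis_box_def half_open_box_def, simplified, rule_format, of k]
      side_le[OF assms, of "axis_index k"] by (simp add: abs_le_iff) 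
  then have "(\<Sum>k\<in>UNIV. \<bar>(x - y) $ k\<bar>) \<le> real CARD('n) * (2 / 2 ^ p j)"
    using sum_bounded_above[of UNIV "\<lambda>k. \<bar>(x - y) $ k\<bar>" "2 / 2 ^ p j"] by simp
  then show "norm (x - y) \<le> real d * (2 / 2 ^ p j)"
    using norm_le_l1_cart[of "x - y"] card by simp
qed simp

section \<open>Sets covered by the shells of one scale\<close>

definition good :: "nat \<Rightarrow> (real ^ 'n) set" where
  "good j = (\<Union>c\<in>{..<N j}. \<Union>z. dyadic_shell (p j) z (\<lambda>k. b j c (axis_index k)))"

lemma shell_subset_basis_box:
  assumes "c < N j"
  shows "dyadic_shell (p j) z (\<lambda>k. b j c (axis_index k)) \<subseteq> basis_box j c z"
proof
  fix x assume x: "x \<in> dyadic_shell (p j) z (\<lambda>k. b j c (axis_index k))"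
  have "of_int (z k) / 2 ^ p j \<le> x $ k \<and> x $ k < of_int (z k) / 2 ^ p j + side j c (axis_index k)" for k
  proof -
    have "of_int (z k) / 2 ^ p j \<le> (of_int (z k) + 1 / 2 ^ (b j c (axis_index k) + 1)) / (2::real) ^ p j"
      by (intro divide_right_mono) auto
    moreover have "(of_int (z k) + 1 / 2 ^ b j c (axis_index k)) / 2 ^ p j
        \<le> of_int (z k) / 2 ^ p j + side j c (axis_index k)"
      using side_bounds(1)[OF assms, of "axis_index k"] by (simp add: add_divide_distrib)
    ultimately show ?thesis
      using x[unfolded dyadic_shell_def half_open_box_def, simplified, rule_format, of k] by simp
  qed
  then show "x \<in> basis_box j c z" by (simp add: basis_box_def half_open_box_def)
qed

lemma sets_good: "good j \<in> sets lebesgue"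
  unfolding good_def using lmeasurable_dyadic_shell by (intro sets.countable_UN'') auto

text \<open>The shells of scale \<open>j\<close> are resolved by the grid on which scale
  \<open>j + 1\<close> starts; this is what makes the scales independent.\<close>

lemma dyadic_determined_good: "dyadic_determined (p (Suc j)) (good j)"
proof -
  have "p j + b j c (axis_index k) + 1 \<le> p (Suc j)" if "c < N j" for c k
    using b_le[OF that, of "axis_index k"] by (simp add: p_Suc)
  then show ?thesis
    unfolding good_def by (auto intro!: dyadic_determined_Union dyadic_determined_shell)
qed

text \<open>Each cell contains \<open>(m + 1) ^ (d - 2)\<close> disjoint shells, one per tuple, each
  filling the proportion \<open>1 / 2 ^ ((d - 2) * m + d)\<close> of the cell.\<close>

lemma density_good:
  "shell_density d (m j) * (1 / 2 ^ p j) ^ CARD('n) \<le> measure lebesgue (dyadic_cell (p j) z \<inter> good j)"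
proof -
  let ?S = "\<lambda>c. dyadic_shell (p j) z (\<lambda>k. b j c (axis_index k))"
  have disj: "disjoint_family_on ?S {..<N j}"
    unfolding disjoint_family_on_def
  proof (intro ballI impI dyadic_shell_disjoint notI)
    fix c c' assume "c \<noteq> c'" and eq: "(\<lambda>k. b j c (axis_index k)) = (\<lambda>k. b j c' (axis_index k))"
    have "b j c i = b j c' i" if "i \<in> {1..d}" for i
      using fun_cong[OF eq, of "e i"] axis_index_e[OF that] by simp
    then have "c = c'" unfolding b_def by (rule exponent_inj[OF d])
    then show False using \<open>c \<noteq> c'\<close> by simp
  qed
  have "measure lebesgue (?S c) = (1 / 2 ^ p j) ^ CARD('n) / 2 ^ ((d - 2) * m j + d)" if "c < N j" for c
  proof -
    have "(\<Sum>k\<in>UNIV. b j c (axis_index k)) = (\<Sum>i=1..d. b j c i)"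
      by (rule sum.reindex_bij_betw[OF bij_axis_index])
    also have "\<dots> = (d - 2) * m j"
      using sum_exponent[OF d] that by (simp add: b_def N_def)
    finally show ?thesis by (simp add: measure_dyadic_shell card)
  qed
  then have "shell_density d (m j) * (1 / 2 ^ p j) ^ CARD('n) = (\<Sum>c<N j. measure lebesgue (?S c))"
    by (simp add: shell_density_def N_def)
  also have "\<dots> = measure lebesgue (\<Union>c<N j. ?S c)"
    using disj by (intro measure_finite_Union[symmetric])
      (simp_all add: image_subset_iff fmeasurableD[OF lmeasurable_dyadic_shell]
        fmeasurableD2[OF lmeasurable_dyadic_shell] del: emeasure_completion)
  also have "\<dots> \<le> measure lebesgue (dyadic_cell (p j) z \<inter> good j)"
  proof (rule measure_mono_fmeasurable)
    show "(\<Union>c<N j. ?S c) \<subseteq> dyadic_cell (p j) z \<inter> good j"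
      using dyadic_shell_subset_cell unfolding good_def by blast
    show "(\<Union>c<N j. ?S c) \<in> sets lebesgue"
      by (intro sets.finite_UN) (auto intro: fmeasurableD[OF lmeasurable_dyadic_shell])
    show "dyadic_cell (p j) z \<inter> good j \<in> lmeasurable"
      by (intro fmeasurable_Int_fmeasurable lmeasurable_dyadic_cell sets_good)
  qed
  finally show ?thesis .
qed

definition unit_box :: "(real ^ 'n) set" where "unit_box = half_open_box (\<lambda>_. 0) (\<lambda>_. 1)"

lemma lmeasurable_unit_box: "unit_box \<in> lmeasurable"
  and measure_unit_box: "measure lebesgue unit_box = 1"
  unfolding unit_box_def by (auto intro!: lmeasurable_half_open_box simp: measure_half_open_box)

text \<open>A divergence half of Borel-Cantelli: what the scales from \<open>J\<close> to
  \<open>J + k - 1\<close> miss is a union of cells of generation \<open>p (J + k)\<close>, so the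
  next scale multiplies its measure by at most 1 minus the density. As 1 - x is at most exp(-x),
  divergence of the densities sends the measure to 0.\<close>

lemma null_unit_box_Diff_good:
  assumes "\<And>B. \<exists>J. B \<le> (\<Sum>j<J. shell_density d (m j))"
  shows "unit_box - (\<Union>j\<in>{J..}. good j) \<in> null_sets lebesgue"
proof -
  let ?S = "\<lambda>k. unit_box - (\<Union>j\<in>{J..<J + k}. good j)"
  have det: "dyadic_determined (p (J + k)) (?S k)" for k
  proof (intro dyadic_determined_Diff dyadic_determined_Union)
    show "dyadic_determined (p (J + k)) unit_box"
      unfolding unit_box_def by (intro dyadic_determined_half_open_box) auto
    fix S assume "S \<in> good ` {J..<J + k}"
    then show "dyadic_determined (p (J + k)) S"
      using dyadic_determined_mono[OF dyadic_determined_good p_mono] by auto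
  qed
  have step: "?S k \<in> lmeasurable"
      "measure lebesgue (?S k - good (J + k)) \<le> (1 - shell_density d (m (J + k))) * measure lebesgue (?S k)" for k
    using measure_dyadic_determined_Diff_le[OF det _ sets_good density_good]
    unfolding unit_box_def by blast+
  have bound: "measure lebesgue (?S k) \<le> exp (- (\<Sum>j\<in>{J..<J + k}. shell_density d (m j)))" for k
  proof (induction k)
    case 0
    then show ?case by (simp add: measure_unit_box)
  next
    case (Suc k)
    have "?S (Suc k) = ?S k - good (J + k)"
      by (auto simp: less_Suc_eq)
    then have "measure lebesgue (?S (Suc k)) \<le> (1 - shell_density d (m (J + k))) * measure lebesgue (?S k)"
      using step(2)[of k] by simp
    also have "\<dots> \<le> exp (- shell_density d (m (J + k))) * exp (- (\<Sum>j\<in>{J..<J + k}. shell_density d (m j)))"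
      using exp_ge_add_one_self[of "- shell_density d (m (J + k))"] Suc
      by (intro mult_mono) auto
    also have "\<dots> = exp (- (\<Sum>j\<in>{J..<J + Suc k}. shell_density d (m j)))"
      by (simp add: exp_add[symmetric])
    finally show ?case .
  qed
  let ?T = "unit_box - (\<Union>j\<in>{J..}. good j)"
  have T: "?T \<in> lmeasurable"
    using sets_good by (intro fmeasurable_Diff lmeasurable_unit_box sets.countable_UN'') auto
  have "measure lebesgue ?T \<le> \<epsilon>" if "0 < \<epsilon>" for \<epsilon>
  proof -
    \<comment> \<open>Divergence concerns sums starting at 0, so \<open>K\<close> also compensates
      for the first \<open>J\<close> terms.\<close>
    obtain K where K: "(\<Sum>j<J. shell_density d (m j)) - ln \<epsilon> \<le> (\<Sum>j<K. shell_density d (m j))"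
      using assms by blast
    also have "\<dots> \<le> (\<Sum>j<J + K. shell_density d (m j))"
      using shell_density_pos by (intro sum_mono2) (auto simp: less_imp_le)
    also have "\<dots> = (\<Sum>j<J. shell_density d (m j)) + (\<Sum>j\<in>{J..<J + K}. shell_density d (m j))"
      by (simp add: atLeast0LessThan[symmetric] sum.atLeastLessThan_concat)
    finally have "- (\<Sum>j\<in>{J..<J + K}. shell_density d (m j)) \<le> ln \<epsilon>" by simp
    then have "exp (- (\<Sum>j\<in>{J..<J + K}. shell_density d (m j))) \<le> \<epsilon>"
      using that by (simp add: ln_ge_iff)
    moreover have "measure lebesgue ?T \<le> measure lebesgue (?S K)"
      using T step(1) by (intro measure_mono_fmeasurable) auto
    ultimately show ?thesis using bound[of K] by simp
  qed
  then have "measure lebesgue ?T = 0"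
    by (intro antisym) (auto intro: field_le_epsilon)
  then show ?thesis using T by (simp add: negligible_iff_measure0[symmetric] negligible_iff_null_sets)
qed

section \<open>Tiny cubes that carry the function\<close>

definition cube :: "nat \<Rightarrow> ('n \<Rightarrow> int) \<Rightarrow> (real ^ 'n) set" where
  "cube j z = half_open_box (\<lambda>k. of_int (z k) / 2 ^ p j)
     (\<lambda>k. of_int (z k) / 2 ^ p j + 1 / 2 ^ (p j + d * m j))"

lemma lmeasurable_cube: "cube j z \<in> lmeasurable"
  and measure_cube: "measure lebesgue (cube j z) = (1 / 2 ^ p j) ^ d * (1 / 2 ^ (d * m j)) ^ d"
  unfolding cube_def
  by (auto intro!: lmeasurable_half_open_box
      simp: measure_half_open_box card power_add power_mult_distrib power_divide)

lemma cube_subset_basis_box: "c < N j \<Longrightarrow> cube j z \<subseteq> basis_box j c z"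
  using side_ge[of c j] unfolding cube_def basis_box_def half_open_box_def
  by (force intro: less_le_trans)

text \<open>Only lattice points in the unit cube are used, so that the total measure is
  finite.\<close>

definition cubes :: "nat \<Rightarrow> (real ^ 'n) set" where
  "cubes j = (\<Union>z\<in>UNIV \<rightarrow>\<^sub>E {0..<2 ^ p j}. cube j z)"

lemma lmeasurable_cubes: "cubes j \<in> lmeasurable"
  unfolding cubes_def using lmeasurable_cube by (intro fmeasurable.finite_UN) (auto simp: finite_PiE)

lemma measure_cubes_le: "measure lebesgue (cubes j) \<le> (1 / 2 ^ (d * m j)) ^ d"
proof -
  let ?Z = "UNIV \<rightarrow>\<^sub>E {0..<2 ^ p j} :: ('n \<Rightarrow> int) set"
  have "measure lebesgue (cubes j) \<le> (\<Sum>z\<in>?Z. measure lebesgue (cube j z))"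
    unfolding cubes_def using lmeasurable_cube by (intro measure_UNION_le) (auto simp: finite_PiE)
  also have "\<dots> = real (card ?Z) * ((1 / 2 ^ p j) ^ d * (1 / 2 ^ (d * m j)) ^ d)"
    by (simp add: measure_cube)
  also have "real (card ?Z) = (2 ^ p j) ^ d"
    by (simp add: card_PiE card nat_power_eq)
  finally show ?thesis by (simp add: power_divide)
qed

end

section \<open>The function\<close>

lemma le_log_plus_powr: "\<bar>u\<bar> \<le> \<bar>u\<bar> * (1 + log_plus \<bar>u\<bar>) powr real n"
proof -
  have "\<bar>u\<bar> * 1 \<le> \<bar>u\<bar> * (1 + log_plus \<bar>u\<bar>) powr real n"
    using log_plus_nonneg[of "\<bar>u\<bar>"] by (intro mult_left_mono ge_one_powr_ge_zero) auto
  then show ?thesis by simp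
qed

lemma L_log_L_integrable:
  assumes "f \<in> L_log_L (real n)"
  shows "integrable lebesgue f"
proof (rule integrableI_bounded)
  show "f \<in> borel_measurable lebesgue" using assms by (simp add: L_log_L_def)
  have "(\<integral>\<^sup>+ x. ennreal (norm (f x)) \<partial>lebesgue) \<le>
      (\<integral>\<^sup>+ x. ennreal (\<bar>f x\<bar> * (1 + log_plus \<bar>f x\<bar>) powr real n) \<partial>lebesgue)"
    using le_log_plus_powr by (intro nn_integral_mono ennreal_leI) simp
  also have "\<dots> < \<infinity>" using assms by (simp add: L_log_L_def)
  finally show "(\<integral>\<^sup>+ x. ennreal (norm (f x)) \<partial>lebesgue) < \<infinity>" .
qed

locale divergent_boxes = sparse_boxes e d m
  for e :: "nat \<Rightarrow> 'n::finite" and d :: nat and m :: "nat \<Rightarrow> nat" +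
  assumes summable_weight: "summable (\<lambda>j. cube_weight d (m j))"
    and suminf_weight: "(\<Sum>j. cube_weight d (m j)) \<le> 1 / 2"
    and divergent_density: "\<And>B. \<exists>J. B \<le> (\<Sum>j<J. shell_density d (m j))"
begin

lemma measure_cubes_le_weight: "measure lebesgue (cubes j) \<le> cube_weight d (m j)"
  using measure_cubes_le cube_weight_ge by (rule order.trans)

lemma summable_cubes: "summable (\<lambda>j. measure lebesgue (cubes j))"
  by (rule summable_comparison_test'[OF summable_weight, of 0]) (simp add: measure_cubes_le_weight)

lemma emeasure_cubes: "emeasure lebesgue (cubes j) = ennreal (measure lebesgue (cubes j))"
  using fmeasurableD2[OF lmeasurable_cubes] by (rule emeasure_eq_ennreal_measure)

lemma emeasure_UN_cubes_le: "emeasure lebesgue (\<Union>j. cubes j) \<le> ennreal (1 / 2)"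
proof -
  have "emeasure lebesgue (\<Union>j. cubes j) \<le> (\<Sum>j. emeasure lebesgue (cubes j))"
    using fmeasurableD[OF lmeasurable_cubes] by (intro emeasure_subadditive_countably) auto
  also have "\<dots> = (\<Sum>j. ennreal (measure lebesgue (cubes j)))" by (simp only: emeasure_cubes)
  also have "\<dots> = ennreal (\<Sum>j. measure lebesgue (cubes j))"
    by (intro suminf_ennreal_eq summable_sums summable_cubes) simp
  also have "\<dots> \<le> ennreal (1 / 2)"
  proof (rule ennreal_leI)
    have "(\<Sum>j. measure lebesgue (cubes j)) \<le> (\<Sum>j. cube_weight d (m j))"
      by (intro suminf_le measure_cubes_le_weight summable_cubes summable_weight)
    then show "(\<Sum>j. measure lebesgue (cubes j)) \<le> 1 / 2"
      using suminf_weight by (rule order.trans)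
  qed
  finally show ?thesis .
qed

lemma null_limsup_cubes: "limsup cubes \<in> null_sets lebesgue"
  using fmeasurableD[OF lmeasurable_cubes] fmeasurableD2[OF lmeasurable_cubes]
  by (intro borel_cantelli_limsup1 summable_cubes) (auto simp: less_top)

text \<open>
  Removing the null set \<open>limsup cubes\<close> leaves finitely many nonzero terms in the supremum \<open>f x\<close>,
  which is therefore attained.
\<close>
definition bad :: "nat \<Rightarrow> (real ^ 'n) set" where "bad j = cubes j - limsup cubes"

definition f :: "real ^ 'n \<Rightarrow> real" where
  "f x = (SUP j. cube_height d (m j) * indicator (bad j) x)"

lemma sets_bad: "bad j \<in> sets lebesgue"
  unfolding bad_def using fmeasurableD[OF lmeasurable_cubes] null_limsup_cubes by (auto intro: null_setsD2)

lemma finite_range_f: "finite (range (\<lambda>j. cube_height d (m j) * indicator (bad j) x))"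
proof -
  obtain n where n: "x \<notin> bad j" if "n \<le> j" for j
  proof (cases "x \<in> limsup cubes")
    case True
    then show ?thesis using that[of 0] by (simp add: bad_def)
  next
    case False
    then obtain n where "\<forall>j\<ge>n. x \<notin> cubes j" by (auto simp: limsup_INF_SUP)
    then show ?thesis using that[of n] by (simp add: bad_def)
  qed
  have "range (\<lambda>j. cube_height d (m j) * indicator (bad j) x)
      \<subseteq> insert 0 ((\<lambda>j. cube_height d (m j) * indicator (bad j) x) ` {..<n})"
  proof (rule image_subsetI)
    fix j
    show "cube_height d (m j) * indicator (bad j) x
      \<in> insert 0 ((\<lambda>j. cube_height d (m j) * indicator (bad j) x) ` {..<n})"
      using n[of j] by (cases "j < n") auto
  qed
  then show ?thesis by (rule finite_subset) simp
qed

lemma f_ge: "cube_height d (m j) * indicator (bad j) x \<le> f x"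
  unfolding f_def by (rule cSUP_upper[OF UNIV_I bdd_above_finite[OF finite_range_f]])

lemma ex_f_eq: "\<exists>j. f x = cube_height d (m j) * indicator (bad j) x"
proof -
  have "f x = Max (range (\<lambda>j. cube_height d (m j) * indicator (bad j) x))"
    unfolding f_def by (rule cSup_eq_Max[OF finite_range_f]) blast
  also have "\<dots> \<in> range (\<lambda>j. cube_height d (m j) * indicator (bad j) x)"
    by (rule Max_in[OF finite_range_f]) blast
  finally show ?thesis by (rule imageE) (rule exI)
qed

lemma f_nonneg: "0 \<le> f x"
proof -
  have "0 \<le> cube_height d (m 0)" using cube_height_ge_1[of d "m 0"] by simp
  then have "0 \<le> cube_height d (m 0) * indicator (bad 0) x" by simp
  then show ?thesis using f_ge by (rule order.trans)
qed

text \<open>At each point a single term attains the supremum, so the integrand for \<open>f\<close>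
  equals that of one term and is at most the sum over all terms. Termwise integration then gives the
  summable weights.\<close>

lemma f_L_log_L: "f \<in> L_log_L (real (d - 3))"
proof -
  define w where "w j = cube_height d (m j) * (1 + log_plus \<bar>cube_height d (m j)\<bar>) powr real (d - 3)" for j
  have w0: "0 \<le> w j" for j
    unfolding w_def using cube_height_ge_1[of d "m j"] by (intro mult_nonneg_nonneg) auto
  have meas: "f \<in> borel_measurable lebesgue"
    unfolding f_def[abs_def]
  proof (rule borel_measurable_cSUP)
    show "(\<lambda>x. cube_height d (m j) * indicator (bad j) x) \<in> borel_measurable lebesgue" for j
      by (intro borel_measurable_times borel_measurable_const borel_measurable_indicator sets_bad)
  qed (simp, rule bdd_above_finite[OF finite_range_f])
  have le: "ennreal (\<bar>f x\<bar> * (1 + log_plus \<bar>f x\<bar>) powr real (d - 3))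
      \<le> (\<Sum>j. ennreal (w j) * indicator (bad j) x)" for x
  proof -
    obtain j where j: "f x = cube_height d (m j) * indicator (bad j) x" using ex_f_eq by blast
    have "ennreal (\<bar>f x\<bar> * (1 + log_plus \<bar>f x\<bar>) powr real (d - 3)) = ennreal (w j) * indicator (bad j) x"
      unfolding j w_def using cube_height_ge_1[of d "m j"] by (auto simp: indicator_def)
    also have "\<dots> = (\<Sum>i\<in>{j}. ennreal (w i) * indicator (bad i) x)"
      by (subst sum.insert) (rule finite.emptyI, blast, simp only: sum.empty add_0_right)
    also have "\<dots> \<le> (\<Sum>j. ennreal (w j) * indicator (bad j) x)" by (intro sum_le_suminf) auto
    finally show ?thesis .
  qed
  have "(\<integral>\<^sup>+ x. ennreal (\<bar>f x\<bar> * (1 + log_plus \<bar>f x\<bar>) powr real (d - 3)) \<partial>lebesgue)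
      \<le> (\<integral>\<^sup>+ x. (\<Sum>j. ennreal (w j) * indicator (bad j) x) \<partial>lebesgue)"
    by (intro nn_integral_mono le)
  also have "\<dots> = (\<Sum>j. ennreal (w j) * emeasure lebesgue (bad j))"
    using sets_bad by (simp add: nn_integral_suminf nn_integral_cmult_indicator del: emeasure_completion)
  also have "\<dots> \<le> (\<Sum>j. ennreal (cube_weight d (m j)))"
  proof (rule suminf_le[OF _ summableI summableI])
    fix j
    have "emeasure lebesgue (bad j) \<le> emeasure lebesgue (cubes j)"
      using fmeasurableD[OF lmeasurable_cubes] by (intro emeasure_mono) (auto simp: bad_def)
    also have "\<dots> \<le> ennreal ((1 / 2 ^ (d * m j)) ^ d)"
      unfolding emeasure_cubes by (intro ennreal_leI measure_cubes_le)
    finally have "ennreal (w j) * emeasure lebesgue (bad j) \<le> ennreal (w j) * ennreal ((1 / 2 ^ (d * m j)) ^ d)"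
      by (rule mult_left_mono) (rule zero_le)
    then show "ennreal (w j) * emeasure lebesgue (bad j) \<le> ennreal (cube_weight d (m j))"
      using w0[of j] by (simp only: cube_weight_def w_def ennreal_mult[symmetric] zero_le_power zero_le_divide_1_iff zero_le_numeral)
  qed
  also have "\<dots> < \<infinity>"
  proof -
    have "0 \<le> cube_weight d (m j)" for j
      using cube_weight_ge[of d "m j"] by (rule order.trans[rotated]) simp
    then have "(\<Sum>j. ennreal (cube_weight d (m j))) \<noteq> top"
      by (rule ennreal_suminf_neq_top[OF summable_weight])
    then show ?thesis by (simp only: less_top infinity_ennreal_def)
  qed
  finally show ?thesis unfolding L_log_L_def using meas by blast
qed

text \<open>A shell containing \<open>x\<close> lies in a basis box that also contains a tiny cube.
  Up to a null set \<open>f\<close> is at least the height there, and height times cube volume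
  dominates the volume of the box.\<close>

lemma average_ge_1:
  assumes x: "x \<in> unit_box" "x \<in> good j"
  obtains R where "R \<in> two_parameter_basis e \<Psi>" "x \<in> R" "diameter R \<le> real d * (2 / 2 ^ p j)"
    "1 \<le> (LINT y:R|lebesgue. f y) / measure lebesgue R"
proof -
  obtain c z where c: "c < N j" and xs: "x \<in> dyadic_shell (p j) z (\<lambda>k. b j c (axis_index k))"
    using x(2) unfolding good_def by auto
  \<comment> \<open>As \<open>x\<close> lies in the unit cube, so does the anchor of its cell; the
    tiny cube at that anchor is thus one of those in \<open>cubes j\<close>.\<close>
  have z: "z \<in> UNIV \<rightarrow>\<^sub>E {0..<2 ^ p j}"
  proof -
    have "\<lfloor>2 ^ p j * x $ k\<rfloor> = z k" for k
      using xs dyadic_shell_subset_cell mem_dyadic_cell_iff by blast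
    moreover have "0 \<le> x $ k" "x $ k < 1" for k
      using x(1) by (auto simp: unit_box_def half_open_box_def)
    ultimately have "0 \<le> z k \<and> z k < 2 ^ p j" for k
      by (simp add: floor_less_iff flip: \<open>\<And>k. \<lfloor>2 ^ p j * x $ k\<rfloor> = z k\<close>)
    then show ?thesis by auto
  qed
  let ?R = "basis_box j c z" let ?Q = "cube j z - limsup cubes"
  have R: "?R \<in> lmeasurable" by (rule lmeasurable_basis_box[OF c])
  have Qsub: "?Q \<subseteq> ?R" "?Q \<subseteq> bad j"
    using cube_subset_basis_box[OF c] z by (auto simp: bad_def cubes_def)
  have Qm: "?Q \<in> lmeasurable" using lmeasurable_cube null_limsup_cubes
    by (intro fmeasurable_Diff) (auto intro: null_setsD2)
  have "measure lebesgue ?Q = measure lebesgue (cube j z)"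
    using fmeasurableD[OF lmeasurable_cube] null_limsup_cubes by (rule measure_Diff_null_set)
  then have mQ: "measure lebesgue ?Q = (1 / 2 ^ p j) ^ d * (1 / 2 ^ (d * m j)) ^ d"
    by (simp add: measure_cube)
  have int: "integrable lebesgue f" by (rule L_log_L_integrable[OF f_L_log_L])
  have "measure lebesgue ?R \<le> 4 / 2 ^ ((d - 2) * m j) * (1 / 2 ^ p j) ^ d"
    by (rule measure_basis_box_le[OF c])
  also have "\<dots> = cube_height d (m j) * measure lebesgue ?Q"
    unfolding mQ cube_height_def by (simp add: power_divide power_mult)
  also have "\<dots> = (LINT y|lebesgue. cube_height d (m j) * indicator ?Q y)"
    using Qm by simp
  also have "\<dots> \<le> (LINT y|lebesgue. indicator ?R y *\<^sub>R f y)"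
  proof (rule integral_mono)
    show "integrable lebesgue (\<lambda>y. cube_height d (m j) * indicator ?Q y)"
      using Qm by (intro integrable_mult_right integrable_real_indicator) (auto simp: fmeasurable_def)
    show "integrable lebesgue (\<lambda>y. indicator ?R y *\<^sub>R f y)"
      using R int by (intro integrable_mult_indicator) auto
    show "cube_height d (m j) * indicator ?Q y \<le> indicator ?R y *\<^sub>R f y" for y
      using Qsub f_ge[of j y] f_nonneg[of y] by (cases "y \<in> ?Q") (auto simp: indicator_def)
  qed
  also have "\<dots> = (LINT y:?R|lebesgue. f y)" by (simp add: set_lebesgue_integral_def)
  finally have "1 \<le> (LINT y:?R|lebesgue. f y) / measure lebesgue ?R"
    using measure_basis_box_pos[OF c] by (simp add: le_divide_eq_1_pos)
  then show thesis
    using bx_in_basis[OF c] subsetD[OF shell_subset_basis_box[OF c] xs] diameter_basis_box_le[OF c]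
    by (intro that[of ?R])
qed

text \<open>Almost every point of the unit cube is in \<open>good j\<close> for arbitrarily large
  \<open>j\<close>, hence in shrinking boxes with averages at least 1. Differentiation would force
  \<open>f x\<close> to be at least 1 there, but \<open>f\<close> vanishes outside a set of measure
  at most 1/2.\<close>

lemma not_differentiates: "\<not> differentiates (two_parameter_basis e \<Psi>) (L_log_L (real (d - 3)))"
proof
  let ?B = "two_parameter_basis e \<Psi>"
  assume "differentiates ?B (L_log_L (real (d - 3)))"
  then have AE: "AE x in lebesgue. \<forall>R :: nat \<Rightarrow> (real ^ 'n) set.
        (\<forall>j. R j \<in> ?B \<and> x \<in> R j) \<and> (\<lambda>j. diameter (R j)) \<longlonglongrightarrow> 0 \<longrightarrow>
        (\<lambda>j. (LINT y:R j|lebesgue. f y) / measure lebesgue (R j)) \<longlonglongrightarrow> f x"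
    using f_L_log_L unfolding differentiates_def by blast
  have "AE x in lebesgue. \<forall>J. x \<notin> unit_box - (\<Union>j\<in>{J..}. good j)"
    unfolding AE_all_countable
    by (intro allI AE_not_in null_unit_box_Diff_good divergent_density)
  with AE have "AE x in lebesgue. x \<in> unit_box \<longrightarrow> x \<in> (\<Union>j. cubes j)"
  proof eventually_elim
    case (elim x)
    show ?case
    proof
      assume x: "x \<in> unit_box"
      have "\<exists>R. R \<in> ?B \<and> x \<in> R \<and> diameter R \<le> real d * (2 * (1 / 2) ^ J) \<and>
          1 \<le> (LINT y:R|lebesgue. f y) / measure lebesgue R" for J
      proof -
        obtain j where j: "J \<le> j" "x \<in> good j" using elim(2) x by auto
        have "2 / 2 ^ p j \<le> 2 / (2::real) ^ J"
          using j(1) le_p[of j] by (intro divide_left_mono power_increasing) auto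
        then have le: "real d * (2 / 2 ^ p j) \<le> real d * (2 * (1 / 2) ^ J)"
          by (intro mult_left_mono) (auto simp: power_divide)
        obtain R where R: "R \<in> ?B" "x \<in> R" "diameter R \<le> real d * (2 / 2 ^ p j)"
          "1 \<le> (LINT y:R|lebesgue. f y) / measure lebesgue R"
          by (rule average_ge_1[OF x j(2)])
        then show ?thesis using order.trans[OF R(3) le] by (intro exI[of _ R] conjI)
      qed
      then have "\<forall>J. \<exists>R. R \<in> ?B \<and> x \<in> R \<and> diameter R \<le> real d * (2 * (1 / 2) ^ J) \<and>
          1 \<le> (LINT y:R|lebesgue. f y) / measure lebesgue R" by blast
      from choice[OF this] obtain R where R: "\<And>J. R J \<in> ?B" "\<And>J. x \<in> R J"
        "\<And>J. diameter (R J) \<le> real d * (2 * (1 / 2) ^ J)"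
        "\<And>J. 1 \<le> (LINT y:R J|lebesgue. f y) / measure lebesgue (R J)"
        by blast
      have "bounded (R J)" for J
        using R(1) differentiation_basis_two_parameter_basis[of e \<Psi>] bij card
        unfolding differentiation_basis_def by blast
      then have nonneg: "0 \<le> diameter (R J)" for J by (rule diameter_ge_0)
      have "(\<lambda>J. real d * (2 * (1 / 2) ^ J)) \<longlonglongrightarrow> real d * (2 * 0)"
        by (intro tendsto_intros LIMSEQ_power_zero) simp
      then have lim: "(\<lambda>J. real d * (2 * (1 / 2) ^ J)) \<longlonglongrightarrow> 0" by simp
      have "(\<lambda>J. diameter (R J)) \<longlonglongrightarrow> 0"
        by (rule tendsto_sandwich[OF _ _ tendsto_const lim]) (simp_all add: nonneg R(3))
      then have "(\<lambda>J. (LINT y:R J|lebesgue. f y) / measure lebesgue (R J)) \<longlonglongrightarrow> f x"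
        using elim(1) R(1,2) by blast
      then have "1 \<le> f x"
        using R(4) by (intro LIMSEQ_le_const) auto
      then have "f x \<noteq> 0" by simp
      then obtain j where "x \<in> bad j" using ex_f_eq[of x] by (auto simp: indicator_def split: if_splits)
      then show "x \<in> (\<Union>j. cubes j)" by (auto simp: bad_def)
    qed
  qed
  then have "emeasure lebesgue unit_box \<le> emeasure lebesgue (\<Union>j. cubes j)"
    using fmeasurableD[OF lmeasurable_cubes] by (intro emeasure_mono_AE) auto
  moreover have "emeasure lebesgue unit_box = 1"
    using emeasure_eq_ennreal_measure[OF fmeasurableD2[OF lmeasurable_unit_box]] measure_unit_box by simp
  ultimately have "1 \<le> ennreal (1 / 2)"
    using emeasure_UN_cubes_le by (metis order.trans)
  moreover have "ennreal (1 / 2) < ennreal 1" by (rule ennreal_lessI) simp_all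
  ultimately show False unfolding ennreal_1 by (rule leD[THEN notE])
qed

end

theorem mainTheorem2:
  fixes d :: nat and e :: "nat \<Rightarrow> 'n::finite"
  assumes "d \<ge> 4" and "CARD('n) = d" and "bij_betw e {1..d} UNIV"
  shows "\<exists>\<Psi> :: nat \<Rightarrow> real \<Rightarrow> real \<Rightarrow> real.
    (\<forall>k\<in>{1..d - 2}. (\<forall>s>0. \<forall>t>0. \<Psi> k s t > 0) \<and> nondecreasing_in_both (\<Psi> k)) \<and>
    \<not> differentiates (two_parameter_basis e \<Psi>) (L_log_L (real (d - 3)))"
proof -
  have d: "3 \<le> d" using assms(1) by simp
  have weight_nonneg: "0 \<le> cube_weight d n" for n
    using cube_weight_ge[of d n] by (rule order.trans[rotated]) simp
  have density: "0 < shell_density d n \<and> shell_density d n \<le> 1" for n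
    using shell_density_pos shell_density_le_1 by blast
  show ?thesis
  \<comment> \<open>The sequence \<open>m\<close> is fixed first, because the functions
    \<open>\<Psi>\<close> are built from it.\<close>
  proof (rule sequence_summable_not_summable
      [of "cube_weight d" "shell_density d", OF weight_nonneg density])
    show "\<exists>n. cube_weight d n \<le> \<epsilon> * shell_density d n" if "0 < \<epsilon>" for \<epsilon>
      by (rule ex_cube_weight_le_shell_density[OF d that])
    fix m :: "nat \<Rightarrow> nat"
    assume m: "summable (\<lambda>j. cube_weight d (m j))"
      "(\<Sum>j. cube_weight d (m j)) \<le> 1 / 2" "\<And>B. \<exists>J. B \<le> (\<Sum>j<J. shell_density d (m j))"
    have "sparse_boxes e d"
      by (rule sparse_boxes.intro[OF d assms(2,3)])
    then have boxes: "divergent_boxes e d m"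
      using m by (intro divergent_boxes.intro divergent_boxes_axioms.intro)
    show "\<exists>\<Psi> :: nat \<Rightarrow> real \<Rightarrow> real \<Rightarrow> real.
      (\<forall>k\<in>{1..d - 2}. (\<forall>s>0. \<forall>t>0. \<Psi> k s t > 0) \<and> nondecreasing_in_both (\<Psi> k)) \<and>
      \<not> differentiates (two_parameter_basis e \<Psi>) (L_log_L (real (d - 3)))"
    proof (intro exI[of _ "sparse_boxes.\<Psi> d m"] conjI ballI allI impI)
      show "0 < sparse_boxes.\<Psi> d m k s t" if "0 < s" "0 < t" for k s t
        by (rule sparse_boxes.\<Psi>_pos[OF \<open>sparse_boxes e d\<close> that])
      show "nondecreasing_in_both (sparse_boxes.\<Psi> d m k)" for k
        by (rule sparse_boxes.nondecreasing_\<Psi>[OF \<open>sparse_boxes e d\<close>])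
      show "\<not> differentiates (two_parameter_basis e (sparse_boxes.\<Psi> d m)) (L_log_L (real (d - 3)))"
        by (rule divergent_boxes.not_differentiates[OF boxes])
    qed
  qed
qed

end
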